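(* For each integer $n \ge 2$, among all orthogonal $n$-dimensional tori with volume equal to one, the zeta regularized determinant of the Laplacian is uniquely maximized by the torus $\mathbb{R}^n/\mathbb{Z}^n$. That is, for every invertible diagonal real $n\times n$ matrix $D$ with $|\det D| = 1$, the zeta regularized determinant of the Laplacian on $\mathbb{R}^n/D\mathbb{Z}^n$ is at most that on $\mathbb{R}^n/\mathbb{Z}^n$, with equality if and only if $D\mathbb{Z}^n=\mathbb{Z}^n$.
   Context: An orthogonal lattice is a subset of $\mathbb{R}^n$ of the form $D\mathbb{Z}^n$ with $D$ a diagonal invertible real $n\times n$ matrix. An $n$-dimensional orthogonal torus is the flat Riemannian manifold $\mathbb{R}^n/D\mathbb{Z}^n$; its volume is $|\det D|$. For $D=\operatorname{diag}(q_1,\dots,q_n)$, the eigenvalues of the (nonnegative) Laplacian on $\mathbb{R}^n/D\mathbb{Z}^n$, counted with multiplicity, are $\lambda_k = 4\pi^2\sum_{j=1}^n k_j^2/q_j^2$, $k\in\mathbb{Z}^n$. The spectral zeta function is $\zeta_\circ(s)=\sum_{k\in\mathbb{Z}^n\setminus\{0\}}\lambda_k^{-s}$ for $\operatorname{Re}(s)>n/2$. It extends meromorphically to $\mathbb{C}$ and is holomorphic near $s=0$. The zeta regularized determinant of the Laplacian is $e^{-\zeta_\circ'(0)}$, where $\zeta_\circ'(0)$ is computed from this continuation. *)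

theory Defs
  imports "HOL-Complex_Analysis.Complex_Analysis"
begin

definition diagonal_matrix :: "real^'n^'n \<Rightarrow> bool" where
  "diagonal_matrix D \<longleftrightarrow> (\<forall>i j. i \<noteq> j \<longrightarrow> D $ i $ j = 0)"

definition lattice_of :: "real^'n^'n \<Rightarrow> (real^'n) set" where
  "lattice_of D = range (\<lambda>k :: int^'n. D *v (\<chi> i. of_int (k $ i)))"

(* Eigenvalues of the nonnegative Laplacian on the torus R^n / D Z^n, indexed with multiplicity
   by k in Z^n. Only meaningful for invertible diagonal D; the formula reads off the diagonal
   entries q_j = D $ j $ j. *)
definition laplace_eigenvalue :: "real^'n^'n \<Rightarrow> int^'n \<Rightarrow> real" where
  "laplace_eigenvalue D k = 4 * pi\<^sup>2 * (\<Sum>j\<in>UNIV. (of_int (k $ j))\<^sup>2 / (D $ j $ j)\<^sup>2)"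

(* The Dirichlet series; it represents the spectral zeta function for Re s > n/2. *)
definition spectral_zeta :: "real^'n^'n \<Rightarrow> complex \<Rightarrow> complex" where
  "spectral_zeta D s =
     (\<Sum>\<^sub>\<infinity>k\<in>UNIV - {0 :: int^'n}. of_real (laplace_eigenvalue D k) powr (- s))"

(* Z is a meromorphic continuation of the spectral zeta function to the complex plane that is
   holomorphic near 0. Analyticity at 0 is required separately because a function that is
   meromorphic in the library's sense may take arbitrary values at isolated points. *)
definition zeta_continuation :: "real^'n^'n \<Rightarrow> (complex \<Rightarrow> complex) \<Rightarrow> bool" where
  "zeta_continuation D Z \<longleftrightarrow>
     Z meromorphic_on UNIV \<and> Z analytic_on {0} \<and>
     (\<forall>s. Re s > real CARD('n) / 2 \<longrightarrow> Z s = spectral_zeta D s)"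

(* Continuations agree near 0 by the identity theorem, so the description denotes at most one
   number; that number is real because the zeta function is real on the real axis. *)
definition zeta_det :: "real^'n^'n \<Rightarrow> real" where
  "zeta_det D = (THE d. \<exists>Z. zeta_continuation D Z \<and> complex_of_real d = exp (- deriv Z 0))"

end

theory Submission
  imports Defs "HOL-Probability.Probability"
begin

text \<open>
  Write \<open>a j = 1 / q j ^ 2\<close>, so that the product of the \<open>a j\<close> is \<open>1\<close>, let \<open>theta x\<close> be the sum of
  \<open>exp (- pi k^2 x)\<close> over the integers \<open>k\<close>, and let \<open>P a t\<close> be the product of the \<open>theta (t * a j)\<close>. Riemann's
  splitting of the Mellin integral of \<open>P a t - 1\<close> at \<open>t = 1\<close>, together with \<open>theta (1 / x) = sqrt x * theta x\<close>,
  continues the spectral zeta function and shows that \<open>- log det\<close> equals, up to a constant depending only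
  on \<open>n\<close>, the integral over \<open>t \<ge> 1\<close> of \<open>(P a t - 1) / t + (P (1 / a) t - 1) * t powr (n / 2 - 1)\<close>. It therefore
  suffices that \<open>P a t\<close> is minimal exactly at \<open>a = 1\<close> for each \<open>t\<close>. This is Jensen's inequality
  for the strictly convex function \<open>u \<mapsto> log (theta (exp u))\<close>: its derivative is increasing on \<open>u \<ge> 0\<close>
  because the terms \<open>exp (- pi k^2 x)\<close> are tiny for \<open>x \<ge> 1\<close>, and on \<open>u \<le> 0\<close> by the inversion formula.
\<close>

subsection \<open>Jacobi's inversion formula\<close>

text \<open>Logarithms make the volume constraint linear: the \<open>ln (a j)\<close> sum to 0, so
  the tangent lines of \<open>u \<mapsto> ln (theta (exp u))\<close> at \<open>u = ln t\<close> add
  up to a constant. The numbers \<open>1 / a j\<close> also have product 1, so one inequality serves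
  both halves of Riemann's splitting. Only values of the Mellin integrals enter the determinant, not
  their derivatives: \<open>rGamma\<close> vanishes at 0 with derivative 1, so differentiating its
  product with an integral at 0 leaves the integral itself. The obstacle is convexity near
  \<open>x = 0\<close>, where no term of the theta series dominates. By inversion the function at
  \<open>- u\<close> is the function at \<open>u\<close> plus \<open>u / 2\<close>; a linear term
  does not affect convexity, so the estimate for \<open>x \<ge> 1\<close> can be reflected.
  Inversion itself is an instance of Fourier uniqueness: a Gaussian summed over its integer
  translates agrees with the cosine series that has the same coefficients, and both are evaluated at
  0.\<close>

lemma gaussian_cos_integral:
  fixes x c :: real
  assumes "x > 0"
  shows "has_bochner_integral lborel (\<lambda>y. exp (- (pi * x * y\<^sup>2)) * cos (2 * pi * c * y))
           (exp (- (pi * c\<^sup>2 / x)) / sqrt x)"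
proof -
  \<comment> \<open>Under \<open>z = r * y\<close> the Gaussian becomes a multiple of the standard
    normal density and the phase \<open>2 * pi * c * y\<close> becomes \<open>t * z\<close>, so the
    integral is a characteristic function.\<close>
  define r where "r = sqrt (2 * pi * x)"
  have r: "r > 0" "r\<^sup>2 = 2 * pi * x" using assms by (auto simp: r_def)
  define t where "t = 2 * pi * c / r"
  define h where "h = (\<lambda>z. std_normal_density z * cos (t * z))"
  interpret std: real_distribution std_normal_distribution by (rule real_dist_normal_dist)
  have int: "integrable std_normal_distribution (\<lambda>z. iexp (t * z))"
    by (intro std.integrable_const_bound[where B=1]) auto
  have h_int: "integrable lborel h"
    unfolding h_def
    by (rule Bochner_Integration.integrable_bound[of _ std_normal_density])
       (auto simp: abs_mult mult_left_le intro!: integrable_normal_density)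
  have "(LINT z|std_normal_distribution. Re (iexp (t * z))) = Re (char std_normal_distribution t)"
    unfolding char_def using int by (rule integral_Re)
  also have "\<dots> = exp (- t\<^sup>2 / 2)"
    by (simp add: char_std_normal_distribution)
  also have "(LINT z|std_normal_distribution. Re (iexp (t * z))) = (LINT z|lborel. h z)"
    by (subst integral_density) (auto simp: h_def Re_exp)
  finally have h_val: "(LINT z|lborel. h z) = exp (- t\<^sup>2 / 2)" .
  have "has_bochner_integral lborel h (exp (- t\<^sup>2 / 2))"
    using h_int h_val by (simp add: has_bochner_integral_iff)
  hence "has_bochner_integral lborel (\<lambda>y. h (0 + r * y)) (exp (- t\<^sup>2 / 2) /\<^sub>R \<bar>r\<bar>)"
    using lborel_has_bochner_integral_real_affine_iff[of r h "exp (- t\<^sup>2 / 2)" 0] r(1) by blast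
  hence "has_bochner_integral lborel (\<lambda>y. h (r * y)) (exp (- t\<^sup>2 / 2) / r)"
    using r(1) by (simp only: abs_of_pos real_scaleR_def add_0_left divide_inverse mult.commute)
  hence "has_bochner_integral lborel (\<lambda>y. h (r * y) * sqrt (2 * pi)) (exp (- t\<^sup>2 / 2) / r * sqrt (2 * pi))"
    by (intro has_bochner_integral_mult_left)
  moreover have "h (r * y) * sqrt (2 * pi) = exp (- (pi * x * y\<^sup>2)) * cos (2 * pi * c * y)" for y
  proof -
    have "t * (r * y) = 2 * pi * c * y" using r(1) by (simp add: t_def)
    moreover have "- ((r * y)\<^sup>2) / 2 = - (pi * x * y\<^sup>2)" by (simp add: power_mult_distrib r(2))
    ultimately show ?thesis by (simp only: h_def std_normal_density_def) simp
  qed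
  moreover have "exp (- t\<^sup>2 / 2) / r * sqrt (2 * pi) = exp (- (pi * c\<^sup>2 / x)) / sqrt x"
  proof -
    have "t\<^sup>2 = (2 * pi * c)\<^sup>2 / (2 * pi * x)" by (simp only: t_def power_divide r(2))
    hence "t\<^sup>2 / 2 = pi * c\<^sup>2 / x"
      using assms by (simp add: power_mult_distrib field_simps power2_eq_square)
    moreover have "r = sqrt (2 * pi) * sqrt x" by (simp add: r_def real_sqrt_mult)
    ultimately show ?thesis by simp
  qed
  ultimately show ?thesis by simp
qed

definition theta :: "real \<Rightarrow> real" where
  "theta x = 1 + 2 * (\<Sum>k. exp (- (pi * x * (real (Suc k))\<^sup>2)))"

lemma summable_exp_neg: 
  fixes c :: real assumes "c > 0" shows "summable (\<lambda>k::nat. exp (- (c * real k)))"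
proof -
  have "exp (- (c * real k)) = exp (-c) ^ k" for k
    by (simp add: exp_of_nat_mult[symmetric] mult.commute)
  thus ?thesis using assms by (simp add: summable_geometric)
qed

lemma summable_gauss:
  assumes "x > 0" shows "summable (\<lambda>k::nat. exp (- (pi * x * (real k)\<^sup>2)))"
proof (rule summable_comparison_test'[OF summable_exp_neg[of "pi * x"]])
  show "pi * x > 0" using assms by simp
  fix k :: nat
  have "real k \<le> (real k)\<^sup>2" by (cases k) (auto simp: power2_eq_square)
  thus "norm (exp (- (pi * x * (real k)\<^sup>2))) \<le> exp (- (pi * x * real k))"
    using assms by simp
qed

lemma summable_gauss_Suc:
  assumes "x > 0" shows "summable (\<lambda>k::nat. exp (- (pi * x * (real (Suc k))\<^sup>2)))"
  using summable_gauss[OF assms] by (subst summable_Suc_iff)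

section \<open>Uniqueness of symmetric Fourier series\<close>

text \<open>The product formula trades one power of \<open>cos (2 * pi * y)\<close> for shifts of
  \<open>m\<close> by one in both directions; the free frequency \<open>m\<close> is what the
  induction on \<open>p\<close> needs. The case \<open>m = 0\<close> yields orthogonality to all
  polynomials in \<open>cos (2 * pi * y)\<close>.\<close>

lemma integral_orthogonal_cos_powers:
  fixes K :: "real \<Rightarrow> real"
  assumes K: "continuous_on {0..1} K"
    and zero: "\<And>m::int. integral {0..1} (\<lambda>y. K y * cos (2 * pi * m * y)) = 0"
  shows "integral {0..1} (\<lambda>y. K y * cos (2 * pi * y) ^ p * cos (2 * pi * of_int m * y)) = 0"
proof (induction p arbitrary: m)
  case (Suc p)
  let ?I = "\<lambda>m::int. \<lambda>y. K y * cos (2 * pi * y) ^ p * cos (2 * pi * of_int m * y)"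
  have "integral {0..1} (\<lambda>y. K y * cos (2 * pi * y) ^ Suc p * cos (2 * pi * of_int m * y))
      = integral {0..1} (\<lambda>y. (?I (m + 1) y + ?I (m - 1) y) / 2)"
  proof (rule arg_cong[where f="integral {0..1}"], rule ext)
    fix y
    have "cos (2 * pi * y) * cos (2 * pi * of_int m * y)
       = (cos (2 * pi * of_int (m + 1) * y) + cos (2 * pi * of_int (m - 1) * y)) / 2"
    proof -
      have "cos (2 * pi * y - 2 * pi * of_int m * y) = cos (2 * pi * of_int (m - 1) * y)"
        by (subst cos_minus[symmetric]) (simp add: algebra_simps)
      moreover have "cos (2 * pi * y + 2 * pi * of_int m * y) = cos (2 * pi * of_int (m + 1) * y)"
        by (simp add: algebra_simps)
      ultimately show ?thesis by (simp only: cos_times_cos add.commute)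
    qed
    moreover have "K y * C ^ Suc p * X = K y * C ^ p * (C * X)" for C X :: real by simp
    ultimately show "K y * cos (2 * pi * y) ^ Suc p * cos (2 * pi * of_int m * y)
        = (?I (m + 1) y + ?I (m - 1) y) / 2"
      by (simp only: distrib_left times_divide_eq_right)
  qed
  also have "\<dots> = (integral {0..1} (?I (m + 1)) + integral {0..1} (?I (m - 1))) / 2"
    unfolding integral_divide
    by (subst integral_add) (auto intro!: integrable_continuous_real continuous_intros K)
  also have "\<dots> = 0" by (simp only: Suc.IH) simp
  finally show ?case .
qed (use zero in simp)

text \<open>By the symmetry, \<open>K\<close> is a continuous function of \<open>cos (2 * pi * y)\<close>, so the one-dimensional
  Weierstrass theorem applies.\<close>
lemma symmetric_cos_orthogonal_imp_zero:
  fixes K :: "real \<Rightarrow> real"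
  assumes K: "continuous_on {0..1} K"
    and sym: "\<And>y. y \<in> {0..1} \<Longrightarrow> K (1 - y) = K y"
    and zero: "\<And>m::int. integral {0..1} (\<lambda>y. K y * cos (2 * pi * m * y)) = 0"
    and y: "y \<in> {0..1}"
  shows "K y = 0"
proof -
  define g where "g = (\<lambda>c. K (arccos c / (2 * pi)))"
  have gK: "g (cos (2 * pi * y)) = K y" if "y \<in> {0..1}" for y
  proof (cases "y \<le> 1/2")
    case True
    hence "arccos (cos (2 * pi * y)) = 2 * pi * y" using that by (intro arccos_cos) auto
    thus ?thesis by (simp add: g_def)
  next
    case False
    have "cos (2 * pi * (1 - y)) = cos (2 * pi * y)"
      by (simp add: algebra_simps cos_diff)
    moreover have "arccos (cos (2 * pi * (1 - y))) = 2 * pi * (1 - y)"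
      using that False by (intro arccos_cos) auto
    ultimately show ?thesis using sym[OF that] by (simp add: g_def)
  qed
  have g: "continuous_on {-1..1} g"
    unfolding g_def
  proof (rule continuous_on_compose2[OF K])
    show "continuous_on {-1..1} (\<lambda>c. arccos c / (2 * pi))"
      by (intro continuous_intros) auto
    show "(\<lambda>c. arccos c / (2 * pi)) ` {-1..1} \<subseteq> {0..1}"
    proof
      fix z assume "z \<in> (\<lambda>c. arccos c / (2 * pi)) ` {-1..1}"
      then obtain c where c: "c \<in> {-1..1}" and z: "z = arccos c / (2 * pi)" by blast
      have "0 \<le> arccos c" "arccos c \<le> pi" using c by (auto intro: arccos_lbound arccos_ubound)
      thus "z \<in> {0..1}" by (simp add: z)
    qed
  qed
  have ortho: "integral {0..1} (\<lambda>y. K y * q (cos (2 * pi * y))) = 0"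
    if q: "real_polynomial_function q" for q
  proof -
    from q obtain a n where q: "q = (\<lambda>z. \<Sum>i\<le>n. a i * z ^ i)"
      using real_polynomial_function_iff_sum[of q] by auto
    have "integral {0..1} (\<lambda>y. K y * q (cos (2 * pi * y)))
        = integral {0..1} (\<lambda>y. \<Sum>i\<le>n. a i * (K y * cos (2 * pi * y) ^ i))"
      by (simp add: q sum_distrib_left mult_ac)
    also have "\<dots> = (\<Sum>i\<le>n. a i * integral {0..1} (\<lambda>y. K y * cos (2 * pi * y) ^ i))"
      by (subst integral_sum) (auto intro!: integrable_continuous_real continuous_intros K)
    also have "\<dots> = 0"
      using integral_orthogonal_cos_powers[OF K zero, of _ 0] by simp
    finally show ?thesis .
  qed
  obtain M where M: "\<And>y. y \<in> {0..1} \<Longrightarrow> \<bar>K y\<bar> \<le> M"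
    using compact_imp_bounded[OF compact_continuous_image[OF K compact_Icc]]
    by (fastforce simp: bounded_iff)
  have M0: "M \<ge> 0" using M[of 0] by simp
  \<comment> \<open>Replace one factor \<open>K\<close> by a polynomial in the cosine: the error is
    uniformly below \<open>e\<close>, and the polynomial is orthogonal to the other factor.\<close>
  have small: "integral {0..1} (\<lambda>y. K y * K y) \<le> e * M" if "e > 0" for e
  proof -
    obtain q where q: "real_polynomial_function q" "\<And>c. c \<in> {-1..1} \<Longrightarrow> \<bar>g c - q c\<bar> < e"
      using Stone_Weierstrass_real_polynomial_function[OF compact_Icc g \<open>e > 0\<close>] by blast
    have qc: "continuous_on A (\<lambda>y. q (cos (2 * pi * y)))" for A
      by (rule continuous_on_compose2[OF continuous_on_polymonial_function[of q UNIV]])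
         (use q(1) in \<open>auto intro!: continuous_intros simp: real_polynomial_function_eq\<close>)
    have "integral {0..1} (\<lambda>y. K y * K y)
       = integral {0..1} (\<lambda>y. K y * K y) - integral {0..1} (\<lambda>y. K y * q (cos (2 * pi * y)))"
      using ortho[OF q(1)] by simp
    also have "\<dots> = integral {0..1} (\<lambda>y. K y * K y - K y * q (cos (2 * pi * y)))"
      by (rule integral_diff[symmetric])
         (auto intro!: integrable_continuous_real continuous_intros K qc)
    also have "\<dots> \<le> integral {0..1} (\<lambda>y::real. e * M)"
    proof (rule integral_le)
      show "(\<lambda>y. K y * K y - K y * q (cos (2 * pi * y))) integrable_on {0..1}"
        by (auto intro!: integrable_continuous_real continuous_intros K qc)
      fix y :: real assume y: "y \<in> {0..1}"
      have "K y * K y - K y * q (cos (2 * pi * y)) = K y * (g (cos (2 * pi * y)) - q (cos (2 * pi * y)))"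
        by (simp only: gK[OF y] right_diff_distrib)
      also have "\<dots> \<le> \<bar>K y\<bar> * \<bar>g (cos (2 * pi * y)) - q (cos (2 * pi * y))\<bar>"
        by (metis abs_ge_self abs_mult)
      also have "\<dots> \<le> M * e"
        using M[OF y] M0 q(2)[of "cos (2 * pi * y)"] by (intro mult_mono) auto
      finally show "K y * K y - K y * q (cos (2 * pi * y)) \<le> e * M" by (simp add: mult.commute)
    qed auto
    finally show ?thesis by simp
  qed
  have "integral {0..1} (\<lambda>y. K y * K y) \<le> 0"
  proof (rule field_le_epsilon)
    fix e :: real assume "e > 0"
    \<comment> \<open>Dividing by \<open>M + 1\<close> rather than \<open>M\<close> covers
      \<open>M = 0\<close>.\<close>
    have "integral {0..1} (\<lambda>y. K y * K y) \<le> e / (M + 1) * M"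
      by (rule small) (use \<open>e > 0\<close> M0 in auto)
    also have "\<dots> \<le> e" using \<open>e > 0\<close> M0 by (simp add: field_simps)
    finally show "integral {0..1} (\<lambda>y. K y * K y) \<le> 0 + e" by simp
  qed
  moreover have "integral {0..1} (\<lambda>y. K y * K y) \<ge> 0"
    by (rule integral_nonneg) (auto intro!: integrable_continuous_real continuous_intros K)
  ultimately have "integral {0..1} (\<lambda>y. K y * K y) = 0" by simp
  hence "\<forall>y\<in>{0..1}. K y * K y = 0"
    by (subst (asm) integral_eq_0_iff) (auto intro!: continuous_intros K)
  thus ?thesis using y by auto
qed

section \<open>Fourier coefficients of the periodized Gaussian and of cosine series\<close>

lemma integral_symmetric_intervals_tendsto:
  fixes e :: "real \<Rightarrow> real"
  assumes "has_bochner_integral lborel e I"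
  shows "(\<lambda>N. integral {- real N..real N} e) \<longlonglongrightarrow> I"
proof -
  have int: "integrable lborel e" and I: "integral\<^sup>L lborel e = I"
    using assms by (auto simp: has_bochner_integral_iff)
  have "(\<lambda>N. LINT y|lborel. indicator {- real N..real N} y *\<^sub>R e y) \<longlonglongrightarrow> integral\<^sup>L lborel e"
  proof (rule integral_dominated_convergence[where w="\<lambda>y. norm (e y)"])
    show "AE y in lborel. (\<lambda>N. indicator {- real N..real N} y *\<^sub>R e y) \<longlonglongrightarrow> e y"
    proof (rule AE_I2)
      fix y
      have "\<forall>\<^sub>F N in sequentially. indicator {- real N..real N} y *\<^sub>R e y = e y"
        using eventually_ge_at_top[of "nat \<lceil>\<bar>y\<bar>\<rceil>"]
        by eventually_elim (auto simp: indicator_def)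
      thus "(\<lambda>N. indicator {- real N..real N} y *\<^sub>R e y) \<longlonglongrightarrow> e y" by (rule tendsto_eventually)
    qed
  qed (use int in \<open>auto intro!: AE_I2 simp: indicator_def\<close>)
  moreover have "(LINT y|lborel. indicator {- real N..real N} y *\<^sub>R e y) = integral {- real N..real N} e" for N
  proof -
    have "set_integrable lborel {- real N..real N} e"
      using integrable_mult_indicator[OF _ int, of "{- real N..real N}"] by (simp add: set_integrable_def)
    from set_borel_integral_eq_integral(2)[OF this] show ?thesis by (simp add: set_lebesgue_integral_def)
  qed
  ultimately show ?thesis by (simp add: I)
qed

text \<open>The translates of the unit interval by \<open>k\<close> and by \<open>- (k + 1)\<close>,
  for \<open>k < N\<close>, tile the interval from \<open>- N\<close> to \<open>N\<close>.\<close>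

lemma integral_symmetric_interval_folded:
  fixes e :: "real \<Rightarrow> real"
  assumes e: "continuous_on UNIV e"
  shows "integral {0..1} (\<lambda>y. \<Sum>k<N. e (y + real k) + e (y - real (Suc k))) = integral {- real N..real N} e"
proof (induction N)
  case (Suc N)
  have c: "continuous_on A e" for A using e continuous_on_subset by blast
  have c': "continuous_on A (\<lambda>y. e (y + r))" "continuous_on A (\<lambda>y. e (y - r))" for A r
    by (rule continuous_on_compose2[OF e]; auto intro!: continuous_intros)+
  have 1: "integral {0..1} (\<lambda>y. e (y + real N)) = integral {real N..real (Suc N)} e"
    using integral_shift[of 0 "real N" 1 e] c by (simp add: o_def add.commute)
  have 2: "integral {0..1} (\<lambda>y. e (y - real (Suc N))) = integral {- real (Suc N)..- real N} e"
    using integral_shift[of 0 "- real (Suc N)" 1 e] c by (simp add: o_def algebra_simps)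
  have "integral {- real (Suc N)..- real N} e + integral {- real N..real (Suc N)} e
      = integral {- real (Suc N)..real (Suc N)} e"
    by (rule Henstock_Kurzweil_Integration.integral_combine) (auto intro!: integrable_continuous_real c)
  moreover have "integral {- real N..real N} e + integral {real N..real (Suc N)} e
      = integral {- real N..real (Suc N)} e"
    by (rule Henstock_Kurzweil_Integration.integral_combine) (auto intro!: integrable_continuous_real c)
  moreover have "integral {0..1} (\<lambda>y. \<Sum>k<Suc N. e (y + real k) + e (y - real (Suc k))) =
     integral {0..1} (\<lambda>y. \<Sum>k<N. e (y + real k) + e (y - real (Suc k)))
     + (integral {0..1} (\<lambda>y. e (y + real N)) + integral {0..1} (\<lambda>y. e (y - real (Suc N))))"
    unfolding sum.lessThan_Suc
    by (subst integral_add, (auto intro!: integrable_continuous_real continuous_intros c')[2])+ simp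
  ultimately show ?case using Suc.IH 1 2 by linarith
qed simp

text \<open>Unfolding: the cosine has period 1, so each translate supplies the Fourier integral over
  one more unit interval, and together they cover the line. Pairing the shifts \<open>k\<close> and
  \<open>- (k + 1)\<close> makes every \<open>p k\<close> symmetric under
  \<open>y \<mapsto> 1 - y\<close>.\<close>

lemma periodized_gaussian_cos_coeff:
  fixes x :: real and m :: int
  assumes x: "x > 0"
  defines "p \<equiv> \<lambda>k y. exp (- (pi * x * (y + real k)\<^sup>2)) + exp (- (pi * x * (y - real (Suc k))\<^sup>2))"
  shows "continuous_on {0..1} (\<lambda>y. \<Sum>k. p k y)"
    and "integral {0..1} (\<lambda>y. (\<Sum>k. p k y) * cos (2 * pi * of_int m * y))
           = exp (- (pi * (of_int m)\<^sup>2 / x)) / sqrt x"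
proof -
  let ?M = "\<lambda>k::nat. 2 * exp (- (pi * x * (real k)\<^sup>2))"
  \<comment> \<open>On the unit interval both \<open>y + k\<close> and \<open>y - (k + 1)\<close>
    have absolute value at least \<open>k\<close>.\<close>
  have bound: "norm (p k y) \<le> ?M k" if "y \<in> {0..1}" for k y
  proof -
    have "(real k)\<^sup>2 \<le> (y + real k)\<^sup>2" using that by (intro power_mono) auto
    moreover have "(real k)\<^sup>2 \<le> (real (Suc k) - y)\<^sup>2" using that by (intro power_mono) auto
    ultimately have "exp (- (pi * x * (y + real k)\<^sup>2)) \<le> exp (- (pi * x * (real k)\<^sup>2))"
      "exp (- (pi * x * (y - real (Suc k))\<^sup>2)) \<le> exp (- (pi * x * (real k)\<^sup>2))"
      using x by (simp_all add: power2_commute)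
    thus ?thesis unfolding p_def by (simp only: real_norm_def abs_of_pos exp_gt_zero add_pos_pos)
  qed
  have sM: "summable ?M" using summable_gauss[OF x] by (rule summable_mult)
  have u: "uniform_limit {0..1} (\<lambda>n y. \<Sum>k<n. p k y) (\<lambda>y. \<Sum>k. p k y) sequentially"
    by (rule Weierstrass_m_test[OF _ sM]) (use bound in auto)
  have pc: "continuous_on A (p k)" for A k unfolding p_def by (intro continuous_intros)
  show "continuous_on {0..1} (\<lambda>y. \<Sum>k. p k y)"
    by (rule uniform_limit_theorem[OF _ u]) (auto intro!: always_eventually continuous_intros pc)
  let ?c = "\<lambda>y. cos (2 * pi * of_int m * y)"
  have uc: "uniform_limit {0..1} (\<lambda>n y. \<Sum>k<n. p k y * ?c y) (\<lambda>y. \<Sum>k. p k y * ?c y) sequentially"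
  proof (rule Weierstrass_m_test[OF _ sM])
    fix k y assume "y \<in> {0..1::real}"
    have "norm (p k y * ?c y) \<le> norm (p k y) * 1"
      unfolding norm_mult by (intro mult_left_mono) auto
    thus "norm (p k y * ?c y) \<le> ?M k" using bound[OF \<open>y \<in> {0..1}\<close>, of k] by simp
  qed
  define e where "e = (\<lambda>y. exp (- (pi * x * y\<^sup>2)) * ?c y)"
  have ec: "continuous_on UNIV e" unfolding e_def by (intro continuous_intros)
  have per: "cos (2 * pi * of_int m * (y + of_int j)) = ?c y" for y :: real and j :: int
  proof -
    have "2 * pi * of_int m * (y + of_int j) = 2 * pi * of_int m * y + 2 * pi * of_int (m * j)"
      by (simp add: algebra_simps)
    thus ?thesis by (simp add: cos_add cos_int_2pin sin_int_2pin del: of_int_mult)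
  qed
  have pe: "p k y * ?c y = e (y + real k) + e (y - real (Suc k))" for k y
    using per[of y "int k"] per[of y "- int (Suc k)"] by (simp add: p_def e_def algebra_simps)
  obtain I J where IJ: "\<And>n. ((\<lambda>y. \<Sum>k<n. p k y * ?c y) has_integral I n) {0..1}"
      "((\<lambda>y. \<Sum>k. p k y * ?c y) has_integral J) {0..1}" "I \<longlonglongrightarrow> J"
    by (rule uniform_limit_integral[OF uc]) (auto intro!: continuous_intros pc)
  have I: "I = (\<lambda>n. integral {- real n..real n} e)"
    using integral_unique[OF IJ(1)] integral_symmetric_interval_folded[OF ec] by (simp add: pe fun_eq_iff)
  have "I \<longlonglongrightarrow> exp (- (pi * (of_int m)\<^sup>2 / x)) / sqrt x"
    using integral_symmetric_intervals_tendsto[OF gaussian_cos_integral[OF x, of "of_int m"]]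
    unfolding I e_def .
  with IJ(3) have "J = exp (- (pi * (of_int m)\<^sup>2 / x)) / sqrt x" by (rule LIMSEQ_unique)
  moreover have "(\<Sum>k. p k y * ?c y) = (\<Sum>k. p k y) * ?c y" if "y \<in> {0..1}" for y
    by (rule suminf_mult2[symmetric], rule summable_comparison_test'[OF sM]) (use bound that in auto)
  hence "integral {0..1} (\<lambda>y. (\<Sum>k. p k y) * ?c y) = integral {0..1} (\<lambda>y. \<Sum>k. p k y * ?c y)"
    by (intro integral_cong) auto
  ultimately show "integral {0..1} (\<lambda>y. (\<Sum>k. p k y) * ?c y) = exp (- (pi * (of_int m)\<^sup>2 / x)) / sqrt x"
    using IJ(2) by (simp add: integral_unique)
qed

lemma integral_cos_int:
  "integral {0..1} (\<lambda>y. cos (2 * pi * of_int j * y)) = (if j = 0 then 1 else 0)"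
proof (cases "j = 0")
  case False
  let ?r = "2 * pi * of_int j :: real"
  have "((\<lambda>y. cos (?r * y)) has_integral (sin (?r * 1) / ?r - sin (?r * 0) / ?r)) {0..1}"
    using False by (intro fundamental_theorem_of_calculus)
      (auto intro!: derivative_eq_intros simp: has_real_derivative_iff_has_vector_derivative[symmetric])
  thus ?thesis using False by (simp add: integral_unique sin_int_2pin)
qed simp

text \<open>Uniform convergence permits termwise integration. Only the frequency
  \<open>k = |m|\<close> survives, and the square of its cosine has mean 1/2 unless
  \<open>m = 0\<close>.\<close>

lemma cosine_series_coeff:
  fixes b :: "nat \<Rightarrow> real" and m :: int
  assumes b: "summable (\<lambda>k. \<bar>b k\<bar>)"
  shows "continuous_on {0..1} (\<lambda>y. \<Sum>k. b k * cos (2 * pi * real k * y))"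
    and "integral {0..1} (\<lambda>y. (\<Sum>k. b k * cos (2 * pi * real k * y)) * cos (2 * pi * of_int m * y))
           = (if m = 0 then b 0 else b (nat \<bar>m\<bar>) / 2)"
proof -
  let ?f = "\<lambda>k y. b k * cos (2 * pi * real k * y)"
  let ?c = "\<lambda>y. cos (2 * pi * of_int m * y)"
  have bound: "norm (?f k y) \<le> \<bar>b k\<bar>" for k y
    using mult_left_mono[OF abs_cos_le_one, of "\<bar>b k\<bar>" "2 * pi * real k * y"] by (simp add: abs_mult)
  have u: "uniform_limit {0..1} (\<lambda>n y. \<Sum>k<n. ?f k y) (\<lambda>y. \<Sum>k. ?f k y) sequentially"
    by (rule Weierstrass_m_test[OF _ b]) (use bound in auto)
  show "continuous_on {0..1} (\<lambda>y. \<Sum>k. ?f k y)"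
    by (rule uniform_limit_theorem[OF _ u]) (auto intro!: always_eventually continuous_intros)
  have uc: "uniform_limit {0..1} (\<lambda>n y. \<Sum>k<n. ?f k y * ?c y) (\<lambda>y. \<Sum>k. ?f k y * ?c y) sequentially"
  proof (rule Weierstrass_m_test[OF _ b])
    fix k y
    have "norm (?f k y * ?c y) \<le> norm (?f k y) * 1"
      unfolding norm_mult by (intro mult_left_mono) auto
    thus "norm (?f k y * ?c y) \<le> \<bar>b k\<bar>" using bound[of k y] by simp
  qed
  obtain I J where IJ: "\<And>n. ((\<lambda>y. \<Sum>k<n. ?f k y * ?c y) has_integral I n) {0..1}"
      "((\<lambda>y. \<Sum>k. ?f k y * ?c y) has_integral J) {0..1}" "I \<longlonglongrightarrow> J"
    by (rule uniform_limit_integral[OF uc]) (auto intro!: continuous_intros)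
  have coeff: "integral {0..1} (\<lambda>y. ?f k y * ?c y)
        = (if int k = \<bar>m\<bar> then (if m = 0 then b k else b k / 2) else 0)" for k
  proof -
    have "?f k y * ?c y = b k / 2 * (cos (2 * pi * of_int (int k - m) * y) + cos (2 * pi * of_int (int k + m) * y))" for y
    proof -
      have "cos (2 * pi * real k * y) * ?c y
        = (cos (2 * pi * of_int (int k - m) * y) + cos (2 * pi * of_int (int k + m) * y)) / 2"
        by (subst cos_times_cos) (simp add: algebra_simps)
      thus ?thesis by (simp add: mult.assoc)
    qed
    hence "integral {0..1} (\<lambda>y. ?f k y * ?c y) = integral {0..1} (\<lambda>y. b k / 2 *
        (cos (2 * pi * of_int (int k - m) * y) + cos (2 * pi * of_int (int k + m) * y)))"
      by (simp only:)
    also have "\<dots> = b k / 2 * (integral {0..1} (\<lambda>y. cos (2 * pi * of_int (int k - m) * y))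
                 + integral {0..1} (\<lambda>y. cos (2 * pi * of_int (int k + m) * y)))"
      by (subst integral_add[symmetric])
         (auto intro!: integrable_continuous_real continuous_intros simp del: of_int_diff of_int_add)
    finally show ?thesis unfolding integral_cos_int by (auto split: if_splits)
  qed
  have I: "I n = (\<Sum>k<n. if k = nat \<bar>m\<bar> then (if m = 0 then b 0 else b (nat \<bar>m\<bar>) / 2) else 0)" for n
  proof -
    have "I n = (\<Sum>k<n. integral {0..1} (\<lambda>y. ?f k y * ?c y))"
      unfolding integral_unique[OF IJ(1)[of n], symmetric]
      by (rule integral_sum) (auto intro!: integrable_continuous_real continuous_intros)
    also have "\<dots> = (\<Sum>k<n. if k = nat \<bar>m\<bar> then (if m = 0 then b 0 else b (nat \<bar>m\<bar>) / 2) else 0)"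
      unfolding coeff by (rule sum.cong) auto
    finally show ?thesis .
  qed
  have "I \<longlonglongrightarrow> (if m = 0 then b 0 else b (nat \<bar>m\<bar>) / 2)"
  proof (rule tendsto_eventually, rule eventually_mono[OF eventually_gt_at_top[of "nat \<bar>m\<bar>"]])
    fix n assume "n > nat \<bar>m\<bar>"
    thus "I n = (if m = 0 then b 0 else b (nat \<bar>m\<bar>) / 2)"
      unfolding I by (subst sum.delta) auto
  qed
  with IJ(3) have "J = (if m = 0 then b 0 else b (nat \<bar>m\<bar>) / 2)" by (rule LIMSEQ_unique)
  moreover have "(\<Sum>k. ?f k y * ?c y) = (\<Sum>k. ?f k y) * ?c y" for y
    by (rule suminf_mult2[symmetric], rule summable_comparison_test'[OF b]) (use bound in auto)
  ultimately show "integral {0..1} (\<lambda>y. (\<Sum>k. ?f k y) * ?c y) = (if m = 0 then b 0 else b (nat \<bar>m\<bar>) / 2)"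
    using IJ(2) by (simp add: integral_unique)
qed

text \<open>\<open>F\<close> is the periodized Gaussian and \<open>H\<close> the cosine series with
  its Fourier coefficients. The difference is continuous, symmetric and orthogonal to every cosine,
  hence zero; at \<open>y = 0\<close> this is the claim.\<close>

theorem theta_inversion:
  fixes x :: real
  assumes x: "x > 0"
  shows "theta (1 / x) = sqrt x * theta x"
proof -
  define p where "p = (\<lambda>k y. exp (- (pi * x * (y + real k)\<^sup>2)) + exp (- (pi * x * (y - real (Suc k))\<^sup>2)))"
  \<comment> \<open>The factor 2 merges the frequencies \<open>k\<close> and \<open>- k\<close> and
    cancels the 1/2 in \<open>cosine_series_coeff\<close>.\<close>
  define b where "b = (\<lambda>k::nat. (if k = 0 then 1 else 2) * exp (- (pi * (real k)\<^sup>2 / x)) / sqrt x)"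
  define F where "F = (\<lambda>y. \<Sum>k. p k y)"
  define H where "H = (\<lambda>y. \<Sum>k. b k * cos (2 * pi * real k * y))"
  have "summable (\<lambda>k. 2 / sqrt x * exp (- (pi * (1 / x) * (real k)\<^sup>2)))"
    using x by (intro summable_mult summable_gauss) auto
  hence b: "summable (\<lambda>k. \<bar>b k\<bar>)"
    by (rule summable_comparison_test'[where N=0]) (use x in \<open>auto simp: b_def divide_right_mono\<close>)
  have cF: "continuous_on {0..1} F"
    using periodized_gaussian_cos_coeff(1)[OF x] by (simp add: F_def p_def)
  have iF: "integral {0..1} (\<lambda>y. F y * cos (2 * pi * of_int m * y))
           = exp (- (pi * (of_int m)\<^sup>2 / x)) / sqrt x" for m :: int
    using periodized_gaussian_cos_coeff(2)[OF x, of m] by (simp_all add: F_def p_def)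
  have cH: "continuous_on {0..1} H"
    using cosine_series_coeff(1)[OF b] by (simp add: H_def)
  have iH: "integral {0..1} (\<lambda>y. H y * cos (2 * pi * of_int m * y))
           = (if m = 0 then b 0 else b (nat \<bar>m\<bar>) / 2)" for m :: int
    using cosine_series_coeff(2)[OF b, of m] by (simp_all add: H_def)
  have symF: "F (1 - y) = F y" for y
  proof -
    have "p k (1 - y) = p k y" for k
    proof -
      have "(1 - y + real k)\<^sup>2 = (y - real (Suc k))\<^sup>2" "(1 - y - real (Suc k))\<^sup>2 = (y + real k)\<^sup>2"
        by (simp_all add: power2_eq_square algebra_simps)
      thus ?thesis unfolding p_def by simp
    qed
    thus ?thesis by (simp add: F_def)
  qed
  have symH: "H (1 - y) = H y" for y
  proof -
    have "cos (2 * pi * real k * (1 - y)) = cos (2 * pi * real k * y)" for k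
    proof -
      have "2 * pi * real k * (1 - y) = 2 * pi * of_int (int k) - 2 * pi * real k * y"
        by (simp add: algebra_simps)
      thus ?thesis by (simp only: cos_diff cos_int_2pin sin_int_2pin)
    qed
    thus ?thesis by (simp add: H_def)
  qed
  have "F 0 - H 0 = 0"
  proof (rule symmetric_cos_orthogonal_imp_zero[where K="\<lambda>y. F y - H y" and y=0])
    show "continuous_on {0..1} (\<lambda>y. F y - H y)" by (intro continuous_intros cF cH)
    fix m :: int
    have "integral {0..1} (\<lambda>y. (F y - H y) * cos (2 * pi * of_int m * y))
        = integral {0..1} (\<lambda>y. F y * cos (2 * pi * of_int m * y))
          - integral {0..1} (\<lambda>y. H y * cos (2 * pi * of_int m * y))"
      unfolding left_diff_distrib
      by (rule integral_diff) (intro integrable_continuous_real continuous_intros cF cH)+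
    thus "integral {0..1} (\<lambda>y. (F y - H y) * cos (2 * pi * of_int m * y)) = 0"
      unfolding iF iH by (simp add: b_def)
  qed (simp_all add: symF symH)
  moreover have "F 0 = theta x"
  proof -
    let ?e = "\<lambda>k::nat. exp (- (pi * x * (real k)\<^sup>2))"
    have "F 0 = (\<Sum>k. ?e k + ?e (Suc k))" by (simp add: F_def p_def del: of_nat_Suc)
    also have "\<dots> = (\<Sum>k. ?e k) + (\<Sum>k. ?e (Suc k))"
      by (rule suminf_add[symmetric]) (use summable_gauss[OF x] summable_gauss_Suc[OF x] in auto)
    also have "(\<Sum>k. ?e k) = 1 + (\<Sum>k. ?e (Suc k))"
      using suminf_split_head[OF summable_gauss[OF x]] by simp
    finally show ?thesis by (simp add: theta_def)
  qed
  moreover have "H 0 = theta (1 / x) / sqrt x"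
  proof -
    have sb: "summable b" using b summable_rabs_cancel by blast
    have "H 0 = (\<Sum>k. b k)" by (simp add: H_def)
    also have "\<dots> = b 0 + (\<Sum>k. b (Suc k))" using suminf_split_head[OF sb] by simp
    also have "(\<Sum>k. b (Suc k)) = (\<Sum>k. 2 / sqrt x * exp (- (pi * (1 / x) * (real (Suc k))\<^sup>2)))"
      by (simp add: b_def)
    also have "\<dots> = 2 / sqrt x * (\<Sum>k. exp (- (pi * (1 / x) * (real (Suc k))\<^sup>2)))"
      by (rule suminf_mult) (use x summable_gauss_Suc[of "1 / x"] in auto)
    also have "b 0 = 1 / sqrt x" by (simp add: b_def)
    finally show ?thesis by (simp add: theta_def add_divide_distrib)
  qed
  ultimately show ?thesis using x by (simp add: field_simps)
qed

subsection \<open>Strict logarithmic convexity of theta in logarithmic coordinates\<close>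

text \<open>For \<open>q = exp (- pi * x)\<close> the derivative of \<open>q\<close> is
  \<open>- pi * q\<close>, so differentiation multiplies the \<open>n\<close>-th coefficient by
  \<open>- pi * n\<close>; the extra \<open>q\<close> undoes the index shift in
  \<open>diffs\<close>.\<close>

lemma powser_exp_has_derivative:
  fixes c :: "nat \<Rightarrow> real"
  assumes c: "\<And>q. norm q < 1 \<Longrightarrow> summable (\<lambda>n. c n * q ^ n)"
  shows "norm q < 1 \<Longrightarrow> summable (\<lambda>n. real n * c n * q ^ n)"
    and "x > 0 \<Longrightarrow> ((\<lambda>x. \<Sum>n. c n * exp (- (pi * x)) ^ n) has_real_derivative
           - pi * (\<Sum>n. real n * c n * exp (- (pi * x)) ^ n)) (at x)"
proof -
  have d: "summable (\<lambda>n. diffs c n * q ^ n)" if "norm q < 1" for q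
    using termdiff_converges[OF that c] .
  have eq: "real (Suc n) * c (Suc n) * q ^ Suc n = q * (diffs c n * q ^ n)" for n and q :: real
    by (simp add: diffs_def)
  show s: "summable (\<lambda>n. real n * c n * q ^ n)" if "norm q < 1" for q
    using summable_mult[OF d[OF that], of q] by (subst summable_Suc_iff[symmetric]) (simp only: eq)
  assume "x > 0"
  hence q: "norm (exp (- (pi * x))) < 1" by simp
  have "(\<Sum>n. real n * c n * exp (- (pi * x)) ^ n)
      = exp (- (pi * x)) * (\<Sum>n. diffs c n * exp (- (pi * x)) ^ n)"
    using suminf_split_head[OF s[OF q]] suminf_mult[OF d[OF q], of "exp (- (pi * x))"] by (simp only: eq)
  moreover have "((\<lambda>x. \<Sum>n. c n * exp (- (pi * x)) ^ n) has_real_derivative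
      (\<Sum>n. diffs c n * exp (- (pi * x)) ^ n) * (- pi * exp (- (pi * x)))) (at x)"
    by (rule DERIV_chain2[OF termdiffs_strong'[where K=1]])
       (use c q in \<open>auto intro!: derivative_eq_intros\<close>)
  ultimately show "((\<lambda>x. \<Sum>n. c n * exp (- (pi * x)) ^ n) has_real_derivative
           - pi * (\<Sum>n. real n * c n * exp (- (pi * x)) ^ n)) (at x)"
    by (simp add: mult_ac)
qed

text \<open>The coefficients of \<open>theta - 1\<close> as a power series in \<open>exp (- pi * x)\<close>.\<close>
definition theta_coeff :: "nat \<Rightarrow> real" where
  "theta_coeff n = (if n \<in> range (\<lambda>k. (Suc k)\<^sup>2) then 2 else 0)"

text \<open>For \<open>x > 0\<close> this is the sum of
  \<open>k^(2 * j) * exp (- pi * k^2 * x)\<close> over the nonzero integers \<open>k\<close>. Each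
  differentiation in \<open>x\<close> raises \<open>j\<close> by one and costs a factor
  \<open>- pi\<close>.\<close>

definition theta_moment :: "nat \<Rightarrow> real \<Rightarrow> real" where
  "theta_moment j x = (\<Sum>n. real n ^ j * theta_coeff n * exp (- (pi * x)) ^ n)"

lemma theta_coeff_bounds: "0 \<le> theta_coeff n" "theta_coeff n \<le> 2" "theta_coeff 0 = 0" "theta_coeff 1 = 2"
  by (auto simp: theta_coeff_def intro: range_eqI[of _ _ 0])

lemma summable_theta_moment:
  fixes q :: real
  assumes "norm q < 1" shows "summable (\<lambda>n. real n ^ j * theta_coeff n * q ^ n)"
  using assms
proof (induction j arbitrary: q)
  case 0
  have "summable (\<lambda>n. 2 * norm q ^ n)" using 0 by (intro summable_mult summable_geometric) auto
  thus ?case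
    by (rule summable_comparison_test'[where N=0])
       (auto simp: abs_mult power_abs theta_coeff_bounds intro!: mult_right_mono)
next
  case (Suc j)
  from powser_exp_has_derivative(1)[OF Suc.IH Suc.prems] show ?case by (simp add: mult_ac)
qed

lemma theta_moment_deriv:
  assumes "x > 0"
  shows "(theta_moment j has_real_derivative - pi * theta_moment (Suc j) x) (at x)"
  using powser_exp_has_derivative(2)[OF summable_theta_moment assms, of j]
  unfolding theta_moment_def by (simp add: mult_ac)

lemma theta_eq_moment:
  assumes "x > 0" shows "theta x = 1 + theta_moment 0 x"
proof -
  let ?g = "\<lambda>k::nat. (Suc k)\<^sup>2"
  have "strict_mono ?g" by (rule strict_monoI) (simp add: power_strict_mono)
  moreover have "(\<lambda>k. 2 * exp (- (pi * x * (real (Suc k))\<^sup>2))) sums (2 * (\<Sum>k. exp (- (pi * x * (real (Suc k))\<^sup>2))))"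
    by (intro sums_mult summable_sums summable_gauss_Suc assms)
  moreover have "2 * exp (- (pi * x * (real (Suc k))\<^sup>2)) = theta_coeff (?g k) * exp (- (pi * x)) ^ ?g k" for k
    by (simp add: theta_coeff_def exp_of_nat_mult[symmetric] mult_ac del: of_nat_Suc power_Suc)
  ultimately have "(\<lambda>n. theta_coeff n * exp (- (pi * x)) ^ n) sums (2 * (\<Sum>k. exp (- (pi * x * (real (Suc k))\<^sup>2))))"
    using sums_mono_reindex[of ?g "\<lambda>n. theta_coeff n * exp (- (pi * x)) ^ n"] by (simp add: theta_coeff_def)
  thus ?thesis by (simp add: theta_def theta_moment_def sums_iff)
qed

lemma theta_moment_ge:
  assumes "x > 0" shows "2 * exp (- (pi * x)) \<le> theta_moment j x"
proof -
  have "(\<Sum>n\<in>{1}. real n ^ j * theta_coeff n * exp (- (pi * x)) ^ n) \<le> theta_moment j x"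
    unfolding theta_moment_def
    by (rule sum_le_suminf) (use assms summable_theta_moment in \<open>auto simp: theta_coeff_bounds\<close>)
  thus ?thesis using theta_coeff_bounds(4) by simp
qed

lemma theta_moment_pos: "x > 0 \<Longrightarrow> theta_moment j x > 0"
  using theta_moment_ge[of x j] exp_gt_zero[of "- (pi * x)"] by linarith

lemma theta_gt_1: "x > 0 \<Longrightarrow> theta x > 1"
  using theta_moment_pos[of x 0] by (simp add: theta_eq_moment)

text \<open>Termwise, since \<open>n \<ge> 1\<close> wherever the coefficient is nonzero; the
  coefficient at \<open>n = 0\<close> vanishes.\<close>

lemma theta_moment_mono:
  assumes "x > 0" shows "theta_moment j x \<le> theta_moment (Suc j) x"
  unfolding theta_moment_def
proof (rule suminf_le)
  fix n show "real n ^ j * theta_coeff n * exp (- (pi * x)) ^ n \<le> real n ^ Suc j * theta_coeff n * exp (- (pi * x)) ^ n"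
    using mult_right_mono[of 1 "real n" "real n ^ j * theta_coeff n * exp (- (pi * x)) ^ n"]
    by (cases "n = 0") (auto simp: theta_coeff_bounds mult_ac)
qed (use assms summable_theta_moment[of "exp (- (pi * x))"] in \<open>auto simp del: power_Suc\<close>)

text \<open>All coefficients are at most 2, which leaves a differentiated geometric series.\<close>

lemma theta_moment_1_le:
  assumes "x > 0"
  shows "theta_moment 1 x \<le> 2 * exp (- (pi * x)) / (1 - exp (- (pi * x)))\<^sup>2"
proof -
  let ?q = "exp (- (pi * x))"
  have q: "norm ?q < 1" using assms by simp
  have "(\<lambda>n. 2 * ?q * (real (Suc n) * ?q ^ n)) sums (2 * ?q * (1 / (1 - ?q)\<^sup>2))"
    using geometric_deriv_sums[OF q] by (intro sums_mult) simp
  moreover have "2 * ?q * (real (Suc n) * ?q ^ n) = real (Suc n) * 2 * ?q ^ Suc n" for n by simp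
  ultimately have "(\<lambda>n. real (Suc n) * 2 * ?q ^ Suc n) sums (2 * ?q * (1 / (1 - ?q)\<^sup>2))" by (simp only:)
  hence s: "(\<lambda>n. real n * 2 * ?q ^ n) sums (2 * ?q * (1 / (1 - ?q)\<^sup>2))"
    by (subst (asm) sums_Suc_iff) simp
  have "theta_moment 1 x \<le> (\<Sum>n. real n * 2 * ?q ^ n)"
    unfolding theta_moment_def
    by (rule suminf_le)
       (use q summable_theta_moment[of ?q 1] s theta_coeff_bounds in
         \<open>auto simp: sums_iff intro!: mult_right_mono mult_left_mono\<close>)
  thus ?thesis using s by (simp add: sums_iff)
qed

text \<open>The derivative of \<open>log (theta (exp u))\<close> at \<open>u = log x\<close>.\<close>
definition theta_log_deriv :: "real \<Rightarrow> real" where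
  "theta_log_deriv x = - (pi * x * theta_moment 1 x / theta x)"

lemma theta_deriv:
  assumes "x > 0" shows "(theta has_real_derivative - pi * theta_moment 1 x) (at x)"
proof -
  have "((\<lambda>x. 1 + theta_moment 0 x) has_real_derivative - pi * theta_moment 1 x) (at x)"
    using theta_moment_deriv[OF assms, of 0] by (auto intro!: derivative_eq_intros)
  thus ?thesis
    by (rule has_field_derivative_transform_within_open[where S="{0<..}"])
       (use assms in \<open>auto simp: theta_eq_moment\<close>)
qed

text \<open>This is the logarithmic derivative of \<open>theta (1 / x) = sqrt x * theta x\<close>;
  the square root contributes the 1/2.\<close>

lemma theta_log_deriv_inversion:
  assumes x: "x > 0"
  shows "theta_log_deriv (1 / x) = - 1 / 2 - theta_log_deriv x"
proof -
  have th: "theta x > 0" "theta (1 / x) > 0" using theta_gt_1[of x] theta_gt_1[of "1 / x"] x by auto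
  have "((\<lambda>x. theta (1 / x)) has_real_derivative - pi * theta_moment 1 (1 / x) * (- 1 / x\<^sup>2)) (at x)"
    by (rule DERIV_chain2[OF theta_deriv])
       (use x in \<open>auto intro!: derivative_eq_intros simp: power2_eq_square\<close>)
  moreover have "((\<lambda>x. theta (1 / x)) has_real_derivative
      theta x / (2 * sqrt x) + sqrt x * (- pi * theta_moment 1 x)) (at x)"
  proof (rule has_field_derivative_transform_within_open[where S="{0<..}"])
    show "((\<lambda>x. sqrt x * theta x) has_real_derivative
       theta x / (2 * sqrt x) + sqrt x * (- pi * theta_moment 1 x)) (at x)"
      using x by (auto intro!: derivative_eq_intros theta_deriv DERIV_real_sqrt simp: field_simps)
  qed (use x theta_inversion in auto)
  ultimately have eq: "pi * theta_moment 1 (1 / x) / x\<^sup>2 = theta x / (2 * sqrt x) - sqrt x * (pi * theta_moment 1 x)"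
    by (auto dest: DERIV_unique)
  have "pi * (1 / x) * theta_moment 1 (1 / x) = x * (pi * theta_moment 1 (1 / x) / x\<^sup>2)"
    using x by (simp add: power2_eq_square)
  also have "\<dots> = sqrt x * theta x * (1 / 2 - pi * x * theta_moment 1 x / theta x)"
  proof -
    have "x * (theta x / (2 * sqrt x)) = sqrt x * theta x / 2"
      using x by (simp add: field_simps)
    thus ?thesis unfolding eq using th by (simp add: algebra_simps)
  qed
  finally have "pi * (1 / x) * theta_moment 1 (1 / x) / (sqrt x * theta x) = 1 / 2 - pi * x * theta_moment 1 x / theta x"
    using th x by (subst nonzero_mult_div_cancel_left[symmetric, of "sqrt x * theta x"]) auto
  thus ?thesis by (simp only: theta_log_deriv_def theta_inversion[OF x])
qed

text \<open>With \<open>y = pi * x\<close> the sign is that of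
  \<open>(y * T - S) * theta x - y * S\<^sup>2\<close>. Since \<open>theta x > 1\<close> and
  \<open>S \<le> T\<close>, it is enough that \<open>S < 1 / 2\<close> and \<open>y \<ge> 2\<close>:
  then \<open>y * S\<^sup>2 < y * S / 2 \<le> (y - 1) * S \<le> y * T - S\<close>.\<close>

lemma theta_log_deriv_deriv_pos:
  assumes x: "x \<ge> 1"
  shows "\<exists>d>0. (theta_log_deriv has_real_derivative d) (at x)"
proof -
  let ?y = "pi * x" and ?S = "theta_moment 1 x" and ?T = "theta_moment 2 x"
  have x0: "x > 0" using x by simp
  have th: "theta x > 1" using theta_gt_1[OF x0] .
  have S: "?S > 0" "?S \<le> ?T" using theta_moment_pos[OF x0] theta_moment_mono[OF x0, of 1] by (auto simp: numeral_2_eq_2)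
  have d: "(theta_log_deriv has_real_derivative
       pi * ((?y * ?T - ?S) * theta x - ?y * ?S * ?S) / (theta x * theta x)) (at x)"
    unfolding theta_log_deriv_def[abs_def]
    using th x0 theta_moment_deriv[OF x0, of 1]
    by (auto intro!: derivative_eq_intros theta_deriv simp: field_simps numeral_2_eq_2)
  have y: "?y \<ge> 3" using x pi_gt3 mult_mono[of 3 pi 1 x] by simp
  \<comment> \<open>This bounds \<open>S\<close> by \<open>16 / 49\<close>, which is below the
    required \<open>1 / 2\<close>.\<close>
  have q: "exp (- ?y) \<le> 1 / 8"
  proof -
    have "(2::real) ^ 3 \<le> exp 1 ^ 3" using exp_ge_add_one_self[of 1] by (intro power_mono) auto
    also have "exp 1 ^ 3 = exp (3::real)" by (simp add: exp_of_nat_mult[symmetric])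
    also have "\<dots> \<le> exp ?y" using y by simp
    finally have "8 \<le> exp ?y" by simp
    thus ?thesis by (simp add: exp_minus field_simps)
  qed
  have "?S \<le> 2 * exp (- ?y) / (1 - exp (- ?y))\<^sup>2" using theta_moment_1_le[OF x0] .
  also have "\<dots> \<le> 2 * (1 / 8) / (1 - 1 / 8)\<^sup>2"
    using q by (intro frac_le mult_left_mono power_mono) auto
  also have "\<dots> < 1 / 2" by (simp add: power2_eq_square)
  finally have "?S < 1 / 2" .
  hence "?y * ?S * ?S < ?y * ?S * (1 / 2)" using S x0 by (intro mult_strict_left_mono mult_pos_pos) auto
  also have "\<dots> \<le> (?y - 1) * ?S" using y S mult_right_mono[of "?y * (1 / 2)" "?y - 1" ?S] by (simp add: mult_ac)
  also have "\<dots> \<le> ?y * ?T - ?S" using y S mult_left_mono[of ?S ?T ?y] by (simp add: algebra_simps)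
  also have "\<dots> \<le> (?y * ?T - ?S) * theta x"
  proof -
    have "?S \<le> ?y * ?S" using y S mult_right_mono[of 1 ?y ?S] by simp
    also have "\<dots> \<le> ?y * ?T" using y S by (intro mult_left_mono) auto
    finally show ?thesis using th mult_left_mono[of 1 "theta x" "?y * ?T - ?S"] by simp
  qed
  finally show ?thesis using d th by (intro exI[of _ "pi * ((?y * ?T - ?S) * theta x - ?y * ?S * ?S) / (theta x * theta x)"]) auto
qed

text \<open>The derivative settles \<open>x \<ge> 1\<close>. Below 1,
  \<open>x \<mapsto> 1 / x\<close> reverses the order and the inversion rule reverses it again; the
  two ranges meet at 1.\<close>

lemma theta_log_deriv_strict_mono:
  assumes "0 < x" "x < y"
  shows "theta_log_deriv x < theta_log_deriv y"
proof -
  have ge1: "theta_log_deriv x < theta_log_deriv y" if "1 \<le> x" "x < y" for x y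
    using DERIV_pos_imp_increasing[OF that(2), of theta_log_deriv] theta_log_deriv_deriv_pos that(1)
    by (meson order_trans)
  have le1: "theta_log_deriv x < theta_log_deriv y" if "0 < x" "x < y" "y \<le> 1" for x y
    using ge1[of "1 / y" "1 / x"] theta_log_deriv_inversion[of x] theta_log_deriv_inversion[of y] that
    by (simp add: field_simps)
  consider "1 \<le> x" | "y \<le> 1" | "x < 1" "1 < y" by linarith
  thus ?thesis
  proof cases
    case 3 thus ?thesis using le1[of x 1] ge1[of 1 y] assms by simp
  qed (use assms ge1 le1 in auto)
qed

text \<open>Strict convexity in tangent form, at \<open>u = ln t\<close> with displacement
  \<open>ln a\<close>. The derivative of \<open>f\<close> at \<open>b\<close> has the sign of
  \<open>b - 1\<close>, so \<open>f\<close> has its strict minimum at 1.\<close>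

lemma ln_theta_tangent:
  assumes t: "t > 0" and a: "a > 0" "a \<noteq> 1"
  shows "ln (theta t) + theta_log_deriv t * ln a < ln (theta (t * a))"
proof -
  define f where "f = (\<lambda>a. ln (theta (t * a)) - theta_log_deriv t * ln a)"
  have f: "(f has_real_derivative (theta_log_deriv (t * b) - theta_log_deriv t) / b) (at b)" if b: "b > 0" for b
  proof -
    have tb: "t * b > 0" using t b by simp
    have th: "theta (t * b) > 1" using theta_gt_1[OF tb] .
    have "((\<lambda>a. theta (t * a)) has_real_derivative - pi * theta_moment 1 (t * b) * t) (at b)"
      by (rule DERIV_chain2[where f=theta and g="\<lambda>a. t * a", OF theta_deriv[OF tb]]) (auto intro!: derivative_eq_intros)
    hence "(f has_real_derivative (- pi * theta_moment 1 (t * b) * t) / theta (t * b) - theta_log_deriv t / b) (at b)"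
      unfolding f_def using th b by (auto intro!: derivative_eq_intros)
    moreover have "(- pi * theta_moment 1 (t * b) * t) / theta (t * b) = theta_log_deriv (t * b) / b"
      using b by (simp add: theta_log_deriv_def field_simps)
    ultimately show ?thesis by (simp add: diff_divide_distrib)
  qed
  have cont: "continuous_on A f" if "A \<subseteq> {0<..}" for A
    using f that by (meson DERIV_isCont continuous_at_imp_continuous_on greaterThan_iff subsetD)
  have "f 1 < f a"
  proof (cases "a > 1")
    case True
    show ?thesis
    proof (rule DERIV_pos_imp_increasing_open[OF True])
      fix b assume "1 < b" "b < a"
      moreover from this have "theta_log_deriv t < theta_log_deriv (t * b)"
        using theta_log_deriv_strict_mono[of t "t * b"] t by simp
      ultimately show "\<exists>y. (f has_real_derivative y) (at b) \<and> 0 < y"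
        using f[of b] by (intro exI[of _ "(theta_log_deriv (t * b) - theta_log_deriv t) / b"]) simp
    qed (rule cont, auto)
  next
    case False
    hence "a < 1" using a by simp
    thus ?thesis
    proof (rule DERIV_neg_imp_decreasing_open)
      fix b assume "a < b" "b < 1"
      moreover from this have "theta_log_deriv (t * b) < theta_log_deriv t"
        using theta_log_deriv_strict_mono[of "t * b" t] t a by simp
      ultimately show "\<exists>y. (f has_real_derivative y) (at b) \<and> y < 0"
        using f[of b] a
        by (intro exI[of _ "(theta_log_deriv (t * b) - theta_log_deriv t) / b"]) (simp add: divide_less_0_iff)
    qed (rule cont, use a in auto)
  qed
  thus ?thesis by (simp add: f_def)
qed

text \<open>Sum the tangent inequalities over \<open>j\<close>: the slope at \<open>t\<close> is
  common to all \<open>j\<close> and multiplies the sum of the \<open>ln (a j)\<close>, which is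
  0.\<close>

lemma prod_theta_ge:
  fixes a :: "'a::finite \<Rightarrow> real"
  assumes t: "t > 0" and a: "\<And>j. a j > 0" "prod a UNIV = 1"
  shows "theta t ^ CARD('a) \<le> (\<Prod>j\<in>UNIV. theta (t * a j))"
    and "a i \<noteq> 1 \<Longrightarrow> theta t ^ CARD('a) < (\<Prod>j\<in>UNIV. theta (t * a j))"
proof -
  have pos: "theta (t * a j) > 0" "theta t > 0" for j
    using theta_gt_1[of "t * a j"] theta_gt_1[of t] t a by (auto intro: less_trans[OF zero_less_one])
  have le: "ln (theta t) + theta_log_deriv t * ln (a j) \<le> ln (theta (t * a j))" for j
    using ln_theta_tangent[of t "a j"] t a by (cases "a j = 1") auto
  have s0: "(\<Sum>j\<in>UNIV. ln (a j)) = 0"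
    using a less_imp_neq[OF a(1)] by (subst ln_prod[symmetric]) auto
  have s: "(\<Sum>j\<in>UNIV. ln (theta t) + theta_log_deriv t * ln (a j)) = ln (theta t ^ CARD('a))"
    using pos s0 by (simp add: sum.distrib sum_distrib_left[symmetric] ln_prod ln_realpow)
  have s': "(\<Sum>j\<in>UNIV. ln (theta (t * a j))) = ln (\<Prod>j\<in>UNIV. theta (t * a j))"
    using less_imp_neq[OF pos(1)] by (subst ln_prod) auto
  have pp: "(theta t ^ CARD('a)) > 0" "(\<Prod>j\<in>UNIV. theta (t * a j)) > 0"
    using pos by (auto intro!: prod_pos)
  have "(\<Sum>j\<in>UNIV. ln (theta t) + theta_log_deriv t * ln (a j)) \<le> (\<Sum>j\<in>UNIV. ln (theta (t * a j)))"
    by (rule sum_mono) (rule le)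
  thus "theta t ^ CARD('a) \<le> (\<Prod>j\<in>UNIV. theta (t * a j))"
    using pp unfolding s s' by simp
  assume "a i \<noteq> 1"
  hence "\<exists>j\<in>UNIV. ln (theta t) + theta_log_deriv t * ln (a j) < ln (theta (t * a j))"
    using ln_theta_tangent[of t "a i"] t a by auto
  hence "(\<Sum>j\<in>UNIV. ln (theta t) + theta_log_deriv t * ln (a j)) < (\<Sum>j\<in>UNIV. ln (theta (t * a j)))"
    using le by (intro sum_strict_mono_ex1) auto
  thus "theta t ^ CARD('a) < (\<Prod>j\<in>UNIV. theta (t * a j))"
    using pp unfolding s s' by simp
qed

subsection \<open>Mellin integrals over the unit interval\<close>

text \<open>This is what remains of exponential decay at infinity after \<open>u = 1 / t\<close>. It
  outweighs \<open>u powr (- s - 1)\<close> for every \<open>s\<close>, so the Mellin integrals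
  become entire functions.\<close>

definition flat_at_0 :: "(real \<Rightarrow> real) \<Rightarrow> bool" where
  "flat_at_0 h \<longleftrightarrow> (\<forall>m::nat. \<exists>C. \<forall>u. 0 < u \<and> u \<le> 1 \<longrightarrow> \<bar>h u\<bar> \<le> C * u ^ m)"

text \<open>After substituting \<open>u = 1 / t\<close>, the part over \<open>t \<ge> 1\<close> of the Mellin transform of \<open>h (1 / t)\<close> at \<open>s\<close>.
  The junk value \<open>h 0\<close> is harmless because \<open>0 powr z = 0\<close>.\<close>
definition mellin_unit :: "(real \<Rightarrow> real) \<Rightarrow> complex \<Rightarrow> complex" where
  "mellin_unit h s = integral {0..1} (\<lambda>u. of_real (h u) * of_real u powr (- s - 1))"

lemma norm_of_real_powr: "u > 0 \<Longrightarrow> norm (of_real u powr s :: complex) = u powr Re s"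
  by (simp add: norm_powr_real_powr)

text \<open>One constant serves a whole half-plane of exponents, as locally uniform convergence in
  \<open>s\<close> requires.\<close>

lemma flat_at_0_powr_bound:
  assumes "flat_at_0 h"
  obtains C where "C \<ge> 0"
    "\<And>u s. 0 \<le> u \<Longrightarrow> u \<le> 1 \<Longrightarrow> - R \<le> Re s \<Longrightarrow> norm (of_real (h u) * of_real u powr s :: complex) \<le> C * u"
proof -
  \<comment> \<open>The power \<open>|R|\<close> absorbs the singularity, and the spare power of
    \<open>u\<close> makes the bound tend to 0 at 0.\<close>
  define m where "m = nat \<lceil>\<bar>R\<bar>\<rceil> + 1"
  obtain C where C: "\<And>u. 0 < u \<Longrightarrow> u \<le> 1 \<Longrightarrow> \<bar>h u\<bar> \<le> C * u ^ m"
    using assms unfolding flat_at_0_def by meson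
  have C0: "C \<ge> 0" using C[of 1] by simp
  have "norm (of_real (h u) * of_real u powr s :: complex) \<le> C * u" if u: "0 \<le> u" "u \<le> 1" and s: "- R \<le> Re s" for u s
  proof (cases "u = 0")
    case False
    hence u0: "u > 0" using u by simp
    have "norm (of_real (h u) * of_real u powr s :: complex) = \<bar>h u\<bar> * u powr Re s"
      using u0 by (simp add: norm_mult norm_of_real_powr)
    also have "\<dots> \<le> (C * u ^ m) * u powr Re s" by (intro mult_right_mono C u0 u) simp
    also have "\<dots> = C * (u powr real m * u powr Re s)" using u0 by (simp add: powr_realpow)
    also have "u powr real m * u powr Re s = u powr (real m + Re s)" by (simp add: powr_add)
    also have "\<dots> \<le> u powr 1"
    proof (rule powr_mono')
      have "\<bar>R\<bar> + 1 \<le> real m" unfolding m_def by linarith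
      thus "1 \<le> real m + Re s" using s by linarith
    qed (use u in auto)
    finally show ?thesis using u0 C0 by (simp add: mult_left_mono)
  qed simp
  with C0 that show ?thesis by blast
qed

lemma continuous_on_flat_powr:
  fixes s :: complex
  assumes h: "continuous_on {0<..} h" and flat: "flat_at_0 h"
  shows "continuous_on {0..1} (\<lambda>u. of_real (h u) * of_real u powr s :: complex)"
  unfolding continuous_on_eq_continuous_within
proof
  let ?f = "\<lambda>u. of_real (h u) * of_real u powr s :: complex"
  fix u :: real assume u: "u \<in> {0..1}"
  show "continuous (at u within {0..1}) ?f"
  proof (cases "u = 0")
    case True
    obtain C where C: "\<And>v. 0 \<le> v \<Longrightarrow> v \<le> 1 \<Longrightarrow> norm (?f v) \<le> C * v"
      using flat_at_0_powr_bound[OF flat, of "- Re s"] by (metis minus_minus order_refl)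
    have "(?f \<longlongrightarrow> 0) (at 0 within {0..1})"
    proof (rule Lim_null_comparison)
      show "\<forall>\<^sub>F v in at 0 within {0..1}. norm (?f v) \<le> C * v"
        using C by (auto simp: eventually_at_filter)
      show "((\<lambda>v. C * v) \<longlongrightarrow> 0) (at 0 within {0..1})" by (auto intro!: tendsto_eq_intros)
    qed
    thus ?thesis using True by (simp add: continuous_within)
  next
    case False
    hence u0: "u > 0" using u by simp
    have "isCont h u" using h u0 continuous_on_eq_continuous_at[of "{0<..}" h] by auto
    hence "isCont ?f u"
      using u0 by (intro continuous_intros) auto
    thus ?thesis by (rule continuous_at_imp_continuous_at_within)
  qed
qed

text \<open>Cut off the interval at \<open>e n\<close>, where differentiation under the integral is
  unproblematic. The missing piece is at most \<open>C * e n\<close> uniformly on a unit disc, so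
  the limit is locally uniform.\<close>

lemma mellin_unit_holomorphic:
  assumes h: "continuous_on {0<..} h" and flat: "flat_at_0 h"
  shows "mellin_unit h holomorphic_on UNIV"
proof (rule holomorphic_uniform_sequence)
  let ?f = "\<lambda>s u. of_real (h u) * of_real u powr (- s - 1) :: complex"
  define e where "e = (\<lambda>n::nat. inverse (real (Suc n)))"
  have e: "0 < e n" "e n \<le> 1" for n by (auto simp: e_def field_simps)
  show "(\<lambda>s. integral (cbox (e n) 1) (?f s)) holomorphic_on UNIV" for n
  proof (rule leibniz_rule_holomorphic[where fx="\<lambda>s u. of_real (h u) * (exp ((- s - 1) * of_real (ln u)) * - of_real (ln u))"])
    fix s :: complex and u :: real assume "u \<in> cbox (e n) 1"
    hence u: "u > 0" using e[of n] by auto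
    have "((\<lambda>s. of_real (h u) * exp ((- s - 1) * of_real (ln u))) has_field_derivative
        of_real (h u) * (exp ((- s - 1) * of_real (ln u)) * - of_real (ln u))) (at s)"
      by (auto intro!: derivative_eq_intros)
    thus "((\<lambda>s. ?f s u) has_field_derivative
        of_real (h u) * (exp ((- s - 1) * of_real (ln u)) * - of_real (ln u))) (at s)"
      using u by (simp add: powr_def Ln_of_real)
  next
    fix s :: complex
    show "?f s integrable_on cbox (e n) 1"
      by (rule integrable_continuous, rule continuous_on_subset[OF continuous_on_flat_powr[OF h flat]])
         (use e[of n] in auto)
  next
    have hc: "continuous_on (UNIV \<times> cbox (e n) 1) (\<lambda>p::complex \<times> real. h (snd p))"
      by (rule continuous_on_compose2[OF h]) (use e[of n] in \<open>auto intro!: continuous_intros\<close>)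
    have "0 < e n" by (rule e)
    hence "continuous_on (UNIV \<times> cbox (e n) 1) (\<lambda>p. of_real (h (snd p)) *
       (exp ((- fst p - 1) * of_real (ln (snd p))) * - of_real (ln (snd p))) :: complex)"
      by (intro continuous_intros hc) auto
    thus "continuous_on (UNIV \<times> cbox (e n) 1)
       (\<lambda>(s, u). of_real (h u) * (exp ((- s - 1) * of_real (ln u)) * - of_real (ln u)) :: complex)"
      by (simp add: case_prod_unfold)
  qed auto
  fix s0 :: complex
  \<comment> \<open>For \<open>s\<close> within distance 1 of \<open>s0\<close>, the exponent
    \<open>- s - 1\<close> has real part at least \<open>- (|Re s0| + 2)\<close>.\<close>
  obtain C where C0: "C \<ge> 0" and C: "\<And>u s. 0 \<le> u \<Longrightarrow> u \<le> 1 \<Longrightarrow> - (\<bar>Re s0\<bar> + 2) \<le> Re s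
      \<Longrightarrow> norm (of_real (h u) * of_real u powr s :: complex) \<le> C * u"
    using flat_at_0_powr_bound[OF flat] by blast
  have "uniform_limit (cball s0 1) (\<lambda>n s. integral (cbox (e n) 1) (?f s)) (mellin_unit h) sequentially"
  proof (rule uniform_limitI)
    fix \<epsilon> :: real assume "\<epsilon> > 0"
    have "(\<lambda>n. C * e n) \<longlonglongrightarrow> C * 0" unfolding e_def by (intro tendsto_intros LIMSEQ_inverse_real_of_nat)
    hence "\<forall>\<^sub>F n in sequentially. C * e n < \<epsilon>"
      using \<open>\<epsilon> > 0\<close> by (intro order_tendstoD) auto
    thus "\<forall>\<^sub>F n in sequentially. \<forall>s\<in>cball s0 1. dist (integral (cbox (e n) 1) (?f s)) (mellin_unit h s) < \<epsilon>"
    proof eventually_elim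
      case (elim n)
      show ?case
      proof
        fix s assume "s \<in> cball s0 1"
        hence "\<bar>Re (s - s0)\<bar> \<le> 1"
          using abs_Re_le_cmod[of "s - s0"] by (simp add: dist_norm norm_minus_commute)
        hence s: "- (\<bar>Re s0\<bar> + 2) \<le> Re (- s - 1)" by simp
        have int: "?f s integrable_on {0..1}"
          by (rule integrable_continuous_real, rule continuous_on_flat_powr[OF h flat])
        have "integral {0..e n} (?f s) + integral {e n..1} (?f s) = mellin_unit h s"
          unfolding mellin_unit_def
          by (rule Henstock_Kurzweil_Integration.integral_combine) (use e[of n] int in auto)
        moreover have "norm (integral {0..e n} (?f s)) \<le> C * (e n - 0)"
        proof (rule integral_bound)
          show "continuous_on {0..e n} (?f s)"
            by (rule continuous_on_subset[OF continuous_on_flat_powr[OF h flat]]) (use e[of n] in auto)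
          fix u assume u: "u \<in> {0..e n}"
          hence "norm (?f s u) \<le> C * u" using e[of n] s by (intro C) auto
          also have "\<dots> \<le> C * 1" using u e[of n] C0 by (intro mult_left_mono) auto
          finally show "norm (?f s u) \<le> C" by simp
        qed (use e[of n] in auto)
        ultimately have "dist (integral {e n..1} (?f s)) (mellin_unit h s) \<le> C * e n"
          by (simp add: dist_norm norm_minus_commute algebra_simps flip: \<open>_ = mellin_unit h s\<close>)
        thus "dist (integral (cbox (e n) 1) (?f s)) (mellin_unit h s) < \<epsilon>" using elim by simp
      qed
    qed
  qed
  thus "\<exists>d>0. cball s0 d \<subseteq> UNIV \<and>
      uniform_limit (cball s0 d) (\<lambda>n s. integral (cbox (e n) 1) (?f s)) (mellin_unit h) sequentially"
    by (intro exI[of _ 1]) auto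
qed auto

lemma mellin_unit_absolutely_integrable:
  assumes h: "continuous_on {0<..} h" and flat: "flat_at_0 h"
  shows "(\<lambda>u. of_real (h u) * of_real u powr (- s - 1) :: complex) absolutely_integrable_on {0<..1}"
    and "integral {0<..1} (\<lambda>u. of_real (h u) * of_real u powr (- s - 1)) = mellin_unit h s"
proof -
  let ?f = "\<lambda>u. of_real (h u) * of_real u powr (- s - 1) :: complex"
  have "?f absolutely_integrable_on {0..1}"
    by (rule absolutely_integrable_continuous_real, rule continuous_on_flat_powr[OF h flat])
  thus "?f absolutely_integrable_on {0<..1}" by (rule set_integrable_subset) auto
  show "integral {0<..1} ?f = mellin_unit h s"
    unfolding mellin_unit_def by (rule integral_subset_negligible) (auto intro: negligible_subset[of "{0}"])
qed

lemma mellin_unit_of_real: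
  assumes h: "continuous_on {0<..} h" and flat: "flat_at_0 h"
  shows "continuous_on {0..1} (\<lambda>u. h u * u powr (- r - 1))"
    and "mellin_unit h (of_real r) = of_real (integral {0..1} (\<lambda>u. h u * u powr (- r - 1)))"
proof -
  have eq: "of_real (h u) * of_real u powr (- of_real r - 1) = complex_of_real (h u * u powr (- r - 1))"
    if "u \<in> {0..1}" for u
    using that powr_of_real[of u "- r - 1"] by simp
  have "continuous_on {0..1} (\<lambda>u. complex_of_real (h u * u powr (- r - 1)))"
    using continuous_on_flat_powr[OF h flat, of "- of_real r - 1"]
    by (rule continuous_on_eq) (rule eq)
  from continuous_on_Re[OF this] show c: "continuous_on {0..1} (\<lambda>u. h u * u powr (- r - 1))" by simp
  have "((\<lambda>u. complex_of_real (h u * u powr (- r - 1))) has_integral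
      of_real (integral {0..1} (\<lambda>u. h u * u powr (- r - 1)))) {0..1}"
    by (intro has_integral_of_real integrable_integral integrable_continuous_real c)
  thus "mellin_unit h (of_real r) = of_real (integral {0..1} (\<lambda>u. h u * u powr (- r - 1)))"
    unfolding mellin_unit_def using eq by (metis (no_types, lifting) has_integral_eq_rhs integral_cong integral_unique)
qed

text \<open>Raising \<open>x \<le> exp x\<close> at \<open>x = c / (u * M)\<close> to the power
  \<open>M = m + 1\<close> gives \<open>exp (- c / u) \<le> (M * u / c) ^ M\<close>.\<close>

lemma flat_at_0_expI:
  assumes c: "c > 0" and h: "\<And>t. t \<ge> 1 \<Longrightarrow> \<bar>f t\<bar> \<le> C * exp (- (c * t))"
  shows "flat_at_0 (\<lambda>u. f (1 / u))"
  unfolding flat_at_0_def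
proof
  fix m :: nat
  let ?M = "real (Suc m)"
  have C: "C \<ge> 0" using h[of 1] by (smt (verit) exp_gt_zero mult_neg_pos)
  have "\<bar>f (1 / u)\<bar> \<le> C * (?M / c) ^ Suc m * u ^ m" if u: "0 < u" "u \<le> 1" for u
  proof -
    have "c / (u * ?M) \<le> exp (c / (u * ?M))" using exp_ge_add_one_self[of "c / (u * ?M)"] by linarith
    hence "(c / (u * ?M)) ^ Suc m \<le> exp (c / (u * ?M)) ^ Suc m" using u c by (intro power_mono) auto
    also have "\<dots> = exp (c / u)" by (subst exp_of_nat_mult[symmetric]) (simp del: of_nat_Suc)
    finally have "exp (- (c / u)) \<le> inverse ((c / (u * ?M)) ^ Suc m)"
      unfolding exp_minus using u c by (intro le_imp_inverse_le) (auto intro!: zero_less_power divide_pos_pos mult_pos_pos)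
    also have "\<dots> = (?M / c) ^ Suc m * u ^ Suc m"
      by (simp only: power_divide power_mult_distrib inverse_divide) (simp del: power_Suc)
    also have "\<dots> \<le> (?M / c) ^ Suc m * u ^ m"
      using u c by (intro mult_left_mono power_decreasing zero_le_power) auto
    finally have "C * exp (- (c / u)) \<le> C * ((?M / c) ^ Suc m * u ^ m)" using C by (rule mult_left_mono)
    moreover have "\<bar>f (1 / u)\<bar> \<le> C * exp (- (c * (1 / u)))" using u by (intro h) simp
    ultimately show ?thesis by (simp add: mult.assoc)
  qed
  thus "\<exists>C. \<forall>u. 0 < u \<and> u \<le> 1 \<longrightarrow> \<bar>f (1 / u)\<bar> \<le> C * u ^ m" by blast
qed

subsection \<open>Theta products\<close>

lemma theta_has_sum_int:
  assumes x: "x > 0"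
  shows "((\<lambda>m::int. exp (- (pi * x * (of_int m)\<^sup>2))) has_sum theta x) UNIV"
proof -
  let ?f = "\<lambda>m::int. exp (- (pi * x * (of_int m)\<^sup>2))"
  define S where "S = (\<Sum>k. exp (- (pi * x * (real (Suc k))\<^sup>2)))"
  have S: "((\<lambda>k. exp (- (pi * x * (real (Suc k))\<^sup>2))) has_sum S) UNIV"
    using summable_gauss_Suc[OF x] by (intro sums_nonneg_imp_has_sum) (auto simp: S_def)
  have "bij_betw (\<lambda>k. int (Suc k)) UNIV {0<..}"
    by (rule bij_betwI[where g="\<lambda>m. nat (m - 1)"]) auto
  hence pos: "(?f has_sum S) {0<..}"
    using S has_sum_reindex_bij_betw[of "\<lambda>k. int (Suc k)" UNIV "{0<..}" ?f S] by simp
  have "bij_betw (\<lambda>k. - int (Suc k)) UNIV {..<0}"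
    by (rule bij_betwI[where g="\<lambda>m. nat (- m - 1)"]) auto
  hence neg: "(?f has_sum S) {..<0}"
    using S has_sum_reindex_bij_betw[of "\<lambda>k. - int (Suc k)" UNIV "{..<0}" ?f S]
    by (simp del: of_nat_Suc)
  have "(?f has_sum (S + S)) ({0<..} \<union> {..<0})"
    by (rule has_sum_Un_disjoint[OF pos neg]) auto
  hence "(?f has_sum (?f 0 + (S + S))) (insert 0 ({0<..} \<union> {..<0}))"
    by (intro has_sum_insert) auto
  moreover have "insert 0 ({0<..} \<union> {..<0}) = (UNIV :: int set)" by auto
  ultimately show ?thesis by (simp add: theta_def S_def)
qed

definition theta_prod :: "('n::finite \<Rightarrow> real) \<Rightarrow> real \<Rightarrow> real" where
  "theta_prod a t = (\<Prod>j\<in>UNIV. theta (t * a j))"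

text \<open>Multiply out the absolutely convergent one-dimensional series; a choice of one term from
  each is an integer vector.\<close>

lemma theta_prod_has_sum:
  fixes a :: "'n::finite \<Rightarrow> real"
  assumes t: "t > 0" and a: "\<And>j. a j > 0"
  shows "((\<lambda>k::int^'n. exp (- (pi * t * (\<Sum>j\<in>UNIV. a j * (of_int (k $ j))\<^sup>2)))) has_sum theta_prod a t) UNIV"
proof -
  define f where "f = (\<lambda>j (m::int). exp (- (pi * (t * a j) * (of_int m)\<^sup>2)))"
  have f: "(f j has_sum theta (t * a j)) UNIV" for j
    unfolding f_def by (rule theta_has_sum_int) (use t a in simp)
  have abs: "(\<lambda>m. norm (f j m)) summable_on UNIV" for j
    using f[of j] by (simp add: f_def summable_on_def) blast
  have "infsum (\<lambda>g. \<Prod>j\<in>UNIV. f j (g j)) (PiE UNIV (\<lambda>_. UNIV)) = (\<Prod>j\<in>UNIV. infsum (f j) UNIV)"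
    by (rule infsum_prod_PiE_abs[OF finite abs])
  also have "\<dots> = theta_prod a t"
    unfolding theta_prod_def by (intro prod.cong refl infsumI f)
  finally have inf: "infsum (\<lambda>g. \<Prod>j\<in>UNIV. f j (g j)) UNIV = theta_prod a t"
    by (simp add: PiE_UNIV_domain)
  \<comment> \<open>\<open>infsum\<close> is \<open>0\<close> on non-summable families, so a nonzero value already gives summability.\<close>
  have "theta_prod a t > 0"
    unfolding theta_prod_def using theta_gt_1 t a
    by (intro prod_pos) (meson less_trans mult_pos_pos zero_less_one)
  hence "(\<lambda>g. \<Prod>j\<in>UNIV. f j (g j)) summable_on UNIV"
    using inf infsum_not_exists by fastforce
  hence "((\<lambda>g. \<Prod>j\<in>UNIV. f j (g j)) has_sum theta_prod a t) UNIV"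
    using inf by (simp add: has_sum_infsum flip: inf)
  moreover have "bij_betw (\<lambda>(k::int^'n) j. k $ j) UNIV UNIV"
    by (rule bij_betwI[where g=vec_lambda]) auto
  ultimately have "((\<lambda>k::int^'n. \<Prod>j\<in>UNIV. f j (k $ j)) has_sum theta_prod a t) UNIV"
    using has_sum_reindex_bij_betw[of "\<lambda>(k::int^'n) j. k $ j" UNIV UNIV "\<lambda>g. \<Prod>j\<in>UNIV. f j (g j)"] by simp
  moreover have "(\<Prod>j\<in>UNIV. f j (k $ j)) = exp (- (pi * t * (\<Sum>j\<in>UNIV. a j * (of_int (k $ j))\<^sup>2)))" for k :: "int^'n"
    unfolding f_def by (subst exp_sum[symmetric]) (auto simp: sum_distrib_left mult_ac sum_negf)
  ultimately show ?thesis by simp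
qed

definition exp_decay :: "(real \<Rightarrow> real) \<Rightarrow> bool" where
  "exp_decay f \<longleftrightarrow> (\<exists>C c. c > 0 \<and> (\<forall>t\<ge>1. \<bar>f t\<bar> \<le> C * exp (- (c * t))))"

text \<open>Based on \<open>f * g - 1 = (f - 1) + (g - 1) + (f - 1) * (g - 1)\<close>, with the
  smaller of the two rates.\<close>

lemma exp_decay_mult_minus_1:
  assumes f: "exp_decay (\<lambda>t. f t - 1)" and g: "exp_decay (\<lambda>t. g t - 1)"
  shows "exp_decay (\<lambda>t. f t * g t - 1)"
proof -
  obtain C c where c: "c > 0" "\<And>t. t \<ge> 1 \<Longrightarrow> \<bar>f t - 1\<bar> \<le> C * exp (- (c * t))"
    using f unfolding exp_decay_def by blast
  obtain D d where d: "d > 0" "\<And>t. t \<ge> 1 \<Longrightarrow> \<bar>g t - 1\<bar> \<le> D * exp (- (d * t))"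
    using g unfolding exp_decay_def by blast
  have CD: "C \<ge> 0" "D \<ge> 0"
    using c(2)[of 1] d(2)[of 1] by (smt (verit) exp_gt_zero mult_neg_pos)+
  define m where "m = min c d"
  have "\<bar>f t * g t - 1\<bar> \<le> (C + D + C * D) * exp (- (m * t))" if t: "t \<ge> 1" for t
  proof -
    let ?e = "exp (- (m * t))"
    have mt: "m * t \<le> c * t" "m * t \<le> d * t" "0 \<le> m * t"
      using t c(1) d(1) by (auto simp: m_def intro!: mult_right_mono)
    have "C * exp (- (c * t)) \<le> C * ?e" "D * exp (- (d * t)) \<le> D * ?e"
      using mt CD by (auto intro!: mult_left_mono)
    hence F: "\<bar>f t - 1\<bar> \<le> C * ?e" and G: "\<bar>g t - 1\<bar> \<le> D * ?e" using c(2)[OF t] d(2)[OF t] by linarith+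
    have "\<bar>f t - 1\<bar> * \<bar>g t - 1\<bar> \<le> (C * ?e) * (D * ?e)" using F G CD by (intro mult_mono) auto
    also have "\<dots> \<le> (C * ?e) * (D * 1)" using mt CD by (intro mult_left_mono) auto
    finally have FG: "\<bar>(f t - 1) * (g t - 1)\<bar> \<le> C * D * ?e" by (simp add: abs_mult mult_ac)
    have "f t * g t - 1 = (f t - 1) + (g t - 1) + (f t - 1) * (g t - 1)" by (simp add: algebra_simps)
    hence "\<bar>f t * g t - 1\<bar> \<le> C * ?e + D * ?e + C * D * ?e" using F G FG by linarith
    thus ?thesis by (simp add: algebra_simps)
  qed
  moreover have "m > 0" using c d by (simp add: m_def)
  ultimately show ?thesis unfolding exp_decay_def by blast
qed

text \<open>Since \<open>(k + 1)^2 \<ge> 1\<close>, passing from \<open>a\<close> to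
  \<open>t * a\<close> shrinks every term at least by the common factor
  \<open>exp (- pi * a * (t - 1))\<close>.\<close>

lemma exp_decay_theta:
  assumes a: "a > 0" shows "exp_decay (\<lambda>t. theta (t * a) - 1)"
  unfolding exp_decay_def
proof (intro exI conjI allI impI)
  show "pi * a > 0" using a by simp
  fix t :: real assume t: "1 \<le> t"
  let ?g = "\<lambda>x k. exp (- (pi * x * (real (Suc k))\<^sup>2))"
  have s: "summable (?g (t * a))" "summable (?g a)" using summable_gauss_Suc t a by auto
  have "(\<Sum>k. ?g (t * a) k) \<le> (\<Sum>k. ?g a k * exp (- (pi * a * (t - 1))))"
  proof (rule suminf_le)
    fix k
    have "(t - 1) * 1 \<le> (t - 1) * (real (Suc k))\<^sup>2"
      using t by (intro mult_left_mono one_le_power) auto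
    hence "pi * a * ((t - 1) * 1) \<le> pi * a * ((t - 1) * (real (Suc k))\<^sup>2)"
      by (rule mult_left_mono) (use a in simp)
    hence "- (pi * (t * a) * (real (Suc k))\<^sup>2) \<le> - (pi * a * (real (Suc k))\<^sup>2) + - (pi * a * (t - 1))"
      by (simp only: algebra_simps mult_1_right)
    thus "?g (t * a) k \<le> ?g a k * exp (- (pi * a * (t - 1)))"
      unfolding exp_add[symmetric] by simp
  qed (use s in \<open>auto intro: summable_mult2\<close>)
  also have "\<dots> = (\<Sum>k. ?g a k) * exp (- (pi * a * (t - 1)))"
    by (rule suminf_mult2[symmetric]) (rule s)
  also have "exp (- (pi * a * (t - 1))) = exp (pi * a) * exp (- (pi * a * t))"
    by (simp add: exp_add[symmetric] algebra_simps)
  finally have "theta (t * a) - 1 \<le> (theta a - 1) * exp (pi * a) * exp (- (pi * a * t))"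
    unfolding theta_def by simp
  thus "\<bar>theta (t * a) - 1\<bar> \<le> (theta a - 1) * exp (pi * a) * exp (- (pi * a * t))"
    using theta_gt_1[of "t * a"] t a by simp
qed

lemma exp_decay_theta_prod:
  fixes a :: "'n::finite \<Rightarrow> real"
  assumes a: "\<And>j. a j > 0" shows "exp_decay (\<lambda>t. theta_prod a t - 1)"
proof -
  have "exp_decay (\<lambda>t. (\<Prod>j\<in>A. theta (t * a j)) - 1)" if "finite A" for A
    using that
  proof induction
    case empty show ?case by (auto simp: exp_decay_def intro!: exI[of _ 0] exI[of _ 1])
  next
    case (insert j A)
    from exp_decay_mult_minus_1[OF exp_decay_theta[OF a] insert.IH] insert.hyps show ?case by simp
  qed
  thus ?thesis unfolding theta_prod_def by simp
qed

lemma theta_prod_continuous: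
  fixes a :: "'n::finite \<Rightarrow> real"
  assumes a: "\<And>j. a j > 0" shows "continuous_on {0<..} (theta_prod a)"
proof -
  have "continuous_on {0<..} theta"
    using theta_deriv by (intro DERIV_continuous_on) (auto intro: has_field_derivative_at_within)
  hence "continuous_on {0<..} (\<lambda>t. theta (t * a j))" for j
    by (rule continuous_on_compose2) (use a in \<open>auto intro!: continuous_intros\<close>)
  thus ?thesis unfolding theta_prod_def[abs_def] by (intro continuous_on_prod)
qed

text \<open>Because the \<open>a j\<close> have product 1, the square roots combine to a power of
  \<open>t\<close> alone; hence the poles of the zeta function do not depend on
  \<open>a\<close>.\<close>

lemma theta_prod_inversion:
  fixes a :: "'n::finite \<Rightarrow> real"
  assumes t: "t > 0" and a: "\<And>j. a j > 0" "prod a UNIV = 1"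
  shows "theta_prod a t = t powr (- (real CARD('n) / 2)) * theta_prod (\<lambda>j. 1 / a j) (1 / t)"
proof -
  have "theta (t * a j) = sqrt (1 / (t * a j)) * theta (1 / t * (1 / a j))" for j
    using theta_inversion[of "1 / (t * a j)"] t a(1)[of j] by simp
  hence "theta_prod a t = (\<Prod>j\<in>UNIV. sqrt (1 / (t * a j))) * theta_prod (\<lambda>j. 1 / a j) (1 / t)"
    unfolding theta_prod_def by (simp add: prod.distrib)
  also have "(\<Prod>j\<in>UNIV. sqrt (1 / (t * a j))) = sqrt (\<Prod>j\<in>UNIV. 1 / (t * a j))"
  proof -
    have "(\<Prod>j\<in>A. sqrt (1 / (t * a j))) = sqrt (\<Prod>j\<in>A. 1 / (t * a j))" if "finite A" for A
      using that by induction (auto simp: real_sqrt_mult real_sqrt_divide)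
    thus ?thesis by simp
  qed
  also have "(\<Prod>j\<in>UNIV. 1 / (t * a j)) = 1 / t ^ CARD('n)"
    using a(2) by (simp add: prod_dividef prod.distrib)
  also have "sqrt \<dots> = t powr (- (real CARD('n) / 2))"
  proof -
    have "1 / t ^ CARD('n) = t powr (- real CARD('n))" using t by (simp add: powr_minus_divide powr_realpow)
    moreover have "sqrt (t powr (- real CARD('n))) = (t powr (- real CARD('n))) powr (1 / 2)"
      using t by (intro powr_half_sqrt[symmetric]) simp
    ultimately show ?thesis by (simp add: powr_powr)
  qed
  finally show ?thesis .
qed

text \<open>The subtracted 1 is the term of the zero vector. The variable \<open>u = 1 / t\<close>
  puts the range \<open>t \<ge> 1\<close> on the unit interval.\<close>

definition theta_excess :: "('n::finite \<Rightarrow> real) \<Rightarrow> real \<Rightarrow> real" where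
  "theta_excess a u = theta_prod a (1 / u) - 1"

lemma theta_excess_regular:
  fixes a :: "'n::finite \<Rightarrow> real"
  assumes a: "\<And>j. a j > 0"
  shows "continuous_on {0<..} (theta_excess a)" and "flat_at_0 (theta_excess a)"
proof -
  show "continuous_on {0<..} (theta_excess a)"
    unfolding theta_excess_def[abs_def]
    by (intro continuous_intros continuous_on_compose2[OF theta_prod_continuous[OF a]]) auto
  have "\<exists>C c. c > 0 \<and> (\<forall>t\<ge>1. \<bar>theta_prod a t - 1\<bar> \<le> C * exp (- (c * t)))"
    using exp_decay_theta_prod[of a] a by (simp only: exp_decay_def)
  then obtain C c where "c > 0" "\<And>t. t \<ge> 1 \<Longrightarrow> \<bar>theta_prod a t - 1\<bar> \<le> C * exp (- (c * t))"
    by metis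
  from flat_at_0_expI[OF this] show "flat_at_0 (theta_excess a)"
    unfolding theta_excess_def[abs_def] .
qed

subsection \<open>Mellin transforms\<close>

lemma absolutely_integrable_on_eqI:
  assumes "f absolutely_integrable_on S" "\<And>x. x \<in> S \<Longrightarrow> f x = g x"
  shows "g absolutely_integrable_on S"
proof -
  have "(\<lambda>x. indicator S x *\<^sub>R f x) = (\<lambda>x. indicator S x *\<^sub>R g x)"
    using assms(2) by (auto simp: fun_eq_iff split: split_indicator)
  thus ?thesis using assms(1) by (simp add: set_integrable_def)
qed

text \<open>It carries the change of variables for real integrands over to complex ones.\<close>

lemma absolutely_integrable_complex_iff:
  fixes f :: "real \<Rightarrow> complex"
  shows "f absolutely_integrable_on S \<and> integral S f = b \<longleftrightarrow>
    ((\<lambda>x. Re (f x)) absolutely_integrable_on S \<and> integral S (\<lambda>x. Re (f x)) = Re b) \<and>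
    ((\<lambda>x. Im (f x)) absolutely_integrable_on S \<and> integral S (\<lambda>x. Im (f x)) = Im b)"
    (is "?L \<longleftrightarrow> ?R")
proof
  assume L: ?L
  hence int: "f integrable_on S" using set_lebesgue_integral_eq_integral(1) by blast
  show ?R
    using absolutely_integrable_linear[OF conjunct1[OF L] bounded_linear_Re]
      absolutely_integrable_linear[OF conjunct1[OF L] bounded_linear_Im]
      integral_linear[OF int bounded_linear_Re] integral_linear[OF int bounded_linear_Im] L
    by (simp add: o_def)
next
  assume R: ?R
  let ?F = "\<lambda>x. of_real (Re (f x)) + \<i> * of_real (Im (f x))"
  have abs: "(\<lambda>x. complex_of_real (Re (f x))) absolutely_integrable_on S"
    "(\<lambda>x. \<i> * complex_of_real (Im (f x))) absolutely_integrable_on S"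
    using R absolutely_integrable_linear[OF _ bounded_linear_of_real[where 'a=complex]]
      absolutely_integrable_linear[OF _ bounded_linear_compose[OF bounded_linear_mult_right bounded_linear_of_real]]
    unfolding o_def by blast+
  have F: "?F absolutely_integrable_on S" using set_integral_add(1)[OF abs] .
  have "((\<lambda>x. Re (f x)) has_integral Re b) S" "((\<lambda>x. Im (f x)) has_integral Im b) S"
    using R set_lebesgue_integral_eq_integral(1) by (metis integrable_integral)+
  hence "((\<lambda>x. complex_of_real (Re (f x))) has_integral of_real (Re b)) S"
    "((\<lambda>x. \<i> * complex_of_real (Im (f x))) has_integral \<i> * of_real (Im b)) S"
    by (auto intro!: has_integral_mult_right has_integral_of_real)
  from has_integral_add[OF this] have "(?F has_integral (of_real (Re b) + \<i> * of_real (Im b))) S" .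
  with F show ?L by (simp add: complex_eq[symmetric] integral_unique)
qed

lemma absolute_integral_change_of_variables_complex:
  fixes f :: "real \<Rightarrow> complex" and g :: "real \<Rightarrow> real"
  assumes "S \<in> sets lebesgue"
    and "\<And>x. x \<in> S \<Longrightarrow> (g has_field_derivative g' x) (at x within S)"
    and "inj_on g S"
  shows "(\<lambda>x. of_real \<bar>g' x\<bar> * f (g x)) absolutely_integrable_on S \<and>
           integral S (\<lambda>x. of_real \<bar>g' x\<bar> * f (g x)) = b
     \<longleftrightarrow> f absolutely_integrable_on (g ` S) \<and> integral (g ` S) f = b"
  unfolding absolutely_integrable_complex_iff
  using has_absolute_integral_change_of_variables_1'[OF assms, where f="\<lambda>x. Re (f x)" and b="Re b"]
    has_absolute_integral_change_of_variables_1'[OF assms, where f="\<lambda>x. Im (f x)" and b="Im b"]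
  by simp

lemma exp_mellin_transform:
  fixes s :: complex
  assumes s: "Re s > 0" and c: "c > 0"
  shows "(\<lambda>t. of_real (exp (- (c * t))) * of_real t powr (s - 1)) absolutely_integrable_on {0<..}"
    and "integral {0<..} (\<lambda>t. of_real (exp (- (c * t))) * of_real t powr (s - 1)) = Gamma s * of_real c powr (- s)"
proof -
  let ?f = "\<lambda>t. of_real t powr (s - 1) / of_real (exp t) :: complex"
  let ?F = "\<lambda>t. of_real (exp (- (c * t))) * of_real t powr (s - 1) :: complex"
  have img: "(\<lambda>t. c * t) ` {0<..} = {0<..}"
  proof safe
    fix x :: real assume "x > 0"
    thus "x \<in> (\<lambda>t. c * t) ` {0<..}" using c by (intro image_eqI[of _ _ "x / c"]) auto
  qed (use c in auto)
  have "?f absolutely_integrable_on {0<..} \<and> integral {0<..} ?f = Gamma s"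
    using absolutely_integrable_Gamma_integral'[OF s] Gamma_integral_complex'[OF s] by (auto simp: integral_unique)
  hence *: "(\<lambda>t. of_real \<bar>c\<bar> * ?f (c * t)) absolutely_integrable_on {0<..} \<and>
      integral {0<..} (\<lambda>t. of_real \<bar>c\<bar> * ?f (c * t)) = Gamma s"
    using absolute_integral_change_of_variables_complex[of "{0<..}" "\<lambda>t. c * t" "\<lambda>_. c" ?f "Gamma s"] c
    unfolding img by (auto intro!: derivative_eq_intros simp: inj_on_def)
  have eq: "of_real c powr (- s) * (of_real \<bar>c\<bar> * ?f (c * t)) = ?F t" if "t \<in> {0<..}" for t
  proof -
    have "of_real (c * t) powr (s - 1) = of_real c powr (s - 1) * of_real t powr (s - 1)"
      using c that by (simp add: powr_times_real)
    moreover have "of_real c powr (- s) * (of_real c * of_real c powr (s - 1)) = (1 :: complex)"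
      using c by (simp add: powr_diff powr_minus field_simps)
    ultimately show ?thesis using c
      by (simp add: exp_minus field_simps)
  qed
  have "(\<lambda>t. of_real c powr (- s) * (of_real \<bar>c\<bar> * ?f (c * t))) absolutely_integrable_on {0<..}"
    by (rule set_integrable_mult_right) (rule conjunct1[OF *])
  thus "?F absolutely_integrable_on {0<..}"
    by (rule absolutely_integrable_on_eqI) (rule eq)
  have "integral {0<..} ?F = integral {0<..} (\<lambda>t. of_real c powr (- s) * (of_real \<bar>c\<bar> * ?f (c * t)))"
    by (rule integral_cong) (rule eq[symmetric])
  also have "\<dots> = of_real c powr (- s) * Gamma s"
    using * by (subst integral_mult_right) auto
  finally show "integral {0<..} ?F = Gamma s * of_real c powr (- s)" by (simp add: mult.commute)
qed

lemma powr_integral_unit: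
  fixes z :: complex
  assumes z: "Re z > 0"
  shows "(\<lambda>t. of_real t powr (z - 1)) absolutely_integrable_on {0<..1}"
    and "integral {0<..1} (\<lambda>t. of_real t powr (z - 1)) = 1 / z"
proof -
  have z0: "z \<noteq> 0" using z by auto
  have "((\<lambda>t. of_real t powr (z - 1)) has_integral (of_real 1 powr z / z - of_real 0 powr z / z)) {0..1}"
  proof (rule fundamental_theorem_of_calculus_interior)
    show "continuous_on {0..1} (\<lambda>t. of_real t powr z / z)"
      unfolding continuous_on_eq_continuous_within
    proof
      fix t :: real assume t: "t \<in> {0..1}"
      show "continuous (at t within {0..1}) (\<lambda>t. of_real t powr z / z)"
      proof (cases "t = 0")
        case True
        have "((\<lambda>t. of_real t powr z / z) \<longlongrightarrow> 0 / z) (at 0 within {0..1})"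
          using z z0 by (intro tendsto_divide tendsto_powr_complex_0[where b=z] tendsto_const)
            (auto intro!: tendsto_eq_intros)
        thus ?thesis using True by (simp add: continuous_within)
      next
        case False
        hence "t > 0" using t by simp
        hence "isCont (\<lambda>t. of_real t powr z / z) t" using z0 by (intro continuous_intros) auto
        thus ?thesis by (rule continuous_at_imp_continuous_at_within)
      qed
    qed
    fix t :: real assume "t \<in> {0<..<1}"
    hence t: "t > 0" by simp
    have "((\<lambda>w. w powr z / z) has_field_derivative of_real t powr (z - 1)) (at (of_real t))"
      using t z0 by (auto intro!: derivative_eq_intros)
    from has_vector_derivative_real_field[OF this]
    show "((\<lambda>t. of_real t powr z / z) has_vector_derivative of_real t powr (z - 1)) (at t)" .
  qed simp
  hence I: "((\<lambda>t. of_real t powr (z - 1)) has_integral 1 / z) {0..1}" by simp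
  have "(\<lambda>t. of_real t powr (z - 1)) absolutely_integrable_on {0..1}"
  proof (rule absolutely_integrable_integrable_bound)
    show "(\<lambda>t. t powr (Re z - 1)) integrable_on {0..1}"
      using has_integral_powr_from_0[of "Re z - 1" 1] z by (auto simp: integrable_on_def)
    show "norm (of_real t powr (z - 1)) \<le> t powr (Re z - 1)" if "t \<in> {0..1}" for t
      using that by (cases "t = 0") (auto simp: norm_of_real_powr)
  qed (use I in auto)
  thus "(\<lambda>t. of_real t powr (z - 1)) absolutely_integrable_on {0<..1}"
    by (rule set_integrable_subset) auto
  have "integral {0<..1} (\<lambda>t. of_real t powr (z - 1)) = integral {0..1} (\<lambda>t. of_real t powr (z - 1))"
    by (rule integral_subset_negligible) (auto intro: negligible_subset[of "{0}"])
  thus "integral {0<..1} (\<lambda>t. of_real t powr (z - 1)) = 1 / z"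
    using I by (simp add: integral_unique)
qed

text \<open>Over \<open>t \<ge> 1\<close> the substitution \<open>u = 1 / t\<close> gives the first
  term. Over \<open>t \<le> 1\<close> inversion gives the second, and its two elementary powers of
  \<open>t\<close> give the polar terms.\<close>

lemma mellin_theta_prod:
  fixes a :: "'n::finite \<Rightarrow> real" and s :: complex
  assumes a: "\<And>j. a j > 0" "prod a UNIV = 1" and s: "Re s > real CARD('n) / 2"
  defines "F \<equiv> \<lambda>t. of_real (theta_prod a t - 1) * of_real t powr (s - 1) :: complex"
  shows "F absolutely_integrable_on {0<..}"
    and "integral {0<..} F = mellin_unit (theta_excess a) s
           + mellin_unit (theta_excess (\<lambda>j. 1 / a j)) (of_real (real CARD('n) / 2) - s)
           + 1 / (s - of_real (real CARD('n) / 2)) - 1 / s"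
proof -
  define r where "r = real CARD('n) / 2"
  let ?b = "\<lambda>j. 1 / a j"
  have s0: "Re s > 0" "Re (s - of_real r) > 0" using s by (auto simp: r_def intro: le_less_trans)
  have b: "?b j > 0" for j using a(1) by simp
  let ?B = "\<lambda>t. of_real (theta_excess ?b t) * of_real t powr (- (of_real r - s) - 1) :: complex"
  let ?P = "\<lambda>z t. of_real t powr (z - 1) :: complex"
  \<comment> \<open>Here \<open>theta_prod a t\<close> is \<open>t powr (- r)\<close> times
    \<open>theta_excess ?b t + 1\<close>: the 1 produces the pole at \<open>r\<close>, and the 1
    subtracted in \<open>F\<close> produces the pole at 0.\<close>
  have F1: "F t = ?B t + ?P (s - of_real r) t - ?P s t" if "t \<in> {0<..1}" for t
  proof -
    have t: "t > 0" using that by simp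
    have "of_real (theta_prod a t) = of_real t powr (of_real (- r)) * (of_real (theta_excess ?b t) + 1 :: complex)"
      using theta_prod_inversion[OF t a] t powr_of_real[of t "- r"] by (simp add: r_def theta_excess_def)
    moreover have "of_real t powr (of_real (- r)) * of_real t powr (s - 1) = (of_real t powr (s - of_real r - 1) :: complex)"
      by (simp add: powr_add[symmetric] algebra_simps)
    moreover have "(of_real t powr (- (of_real r - s) - 1) :: complex) = of_real t powr (s - of_real r - 1)"
      by (simp add: algebra_simps)
    ultimately show ?thesis unfolding F_def by (simp add: algebra_simps)
  qed
  have B: "?B absolutely_integrable_on {0<..1}" "integral {0<..1} ?B = mellin_unit (theta_excess ?b) (of_real r - s)"
    using mellin_unit_absolutely_integrable[OF theta_excess_regular[of ?b, OF b], of "of_real r - s"] by auto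
  have BPP: "(\<lambda>t. ?B t + ?P (s - of_real r) t - ?P s t) absolutely_integrable_on {0<..1}"
    by (intro set_integral_add(1) set_integral_diff(1) B powr_integral_unit s0)
  have ab1: "F absolutely_integrable_on {0<..1}"
    using BPP by (rule absolutely_integrable_on_eqI) (rule F1[symmetric])
  have int: "?B integrable_on {0<..1}" "?P (s - of_real r) integrable_on {0<..1}" "?P s integrable_on {0<..1}"
    using B(1) powr_integral_unit(1)[OF s0(1)] powr_integral_unit(1)[OF s0(2)]
    by (auto intro: set_lebesgue_integral_eq_integral(1))
  have "integral {0<..1} F = integral {0<..1} (\<lambda>t. ?B t + ?P (s - of_real r) t - ?P s t)"
    by (rule integral_cong) (rule F1)
  also have "\<dots> = integral {0<..1} ?B + integral {0<..1} (?P (s - of_real r)) - integral {0<..1} (?P s)"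
    using int by (simp add: integral_diff integral_add integrable_add)
  finally have I1: "integral {0<..1} F = mellin_unit (theta_excess ?b) (of_real r - s) + 1 / (s - of_real r) - 1 / s"
    by (simp only: B(2) powr_integral_unit(2)[OF s0(1)] powr_integral_unit(2)[OF s0(2)])
  let ?g = "\<lambda>u::real. 1 / u"
  have img: "?g ` {0<..1} = {1..}"
  proof safe
    fix x :: real assume "1 \<le> x"
    thus "x \<in> ?g ` {0<..1}" by (intro image_eqI[of _ _ "1 / x"]) (auto simp: field_simps)
  qed (auto simp: field_simps)
  let ?A = "\<lambda>u. of_real (theta_excess a u) * of_real u powr (- s - 1) :: complex"
  have A: "?A absolutely_integrable_on {0<..1} \<and> integral {0<..1} ?A = mellin_unit (theta_excess a) s"
    using mellin_unit_absolutely_integrable[OF theta_excess_regular[of a, OF a(1)], of s] by auto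
  have AF: "of_real \<bar>- 1 / u\<^sup>2\<bar> * F (?g u) = ?A u" if "u \<in> {0<..1}" for u
  proof -
    have u: "u > 0" using that by simp
    have "of_real (1 / u) powr (s - 1) = (of_real u powr (1 - s) :: complex)"
      using u by (simp add: powr_def Ln_of_real ln_div algebra_simps flip: of_real_divide)
    moreover have "of_real (1 / u\<^sup>2) * of_real u powr (1 - s) = (of_real u powr (- s - 1) :: complex)"
      using u by (simp add: powr_diff powr_minus field_simps power2_eq_square)
    moreover have "of_real \<bar>- 1 / u\<^sup>2\<bar> * F (?g u)
        = of_real (theta_excess a u) * (of_real (1 / u\<^sup>2) * of_real (1 / u) powr (s - 1))"
      using u unfolding F_def theta_excess_def by (simp add: mult_ac)
    ultimately show ?thesis by (simp only:)
  qed
  have "(\<lambda>u. of_real \<bar>- 1 / u\<^sup>2\<bar> * F (?g u)) absolutely_integrable_on {0<..1}"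
    using conjunct1[OF A] by (rule absolutely_integrable_on_eqI) (rule AF[symmetric])
  moreover have "integral {0<..1} (\<lambda>u. of_real \<bar>- 1 / u\<^sup>2\<bar> * F (?g u)) = mellin_unit (theta_excess a) s"
  proof -
    have "integral {0<..1} (\<lambda>u. of_real \<bar>- 1 / u\<^sup>2\<bar> * F (?g u)) = integral {0<..1} ?A"
      by (rule integral_cong) (rule AF)
    thus ?thesis using A by (simp only:)
  qed
  moreover have "(?g has_field_derivative - 1 / u\<^sup>2) (at u within {0<..1})" if "u \<in> {0<..1}" for u
    using that by (auto intro!: derivative_eq_intros simp: power2_eq_square)
  ultimately have F2: "F absolutely_integrable_on {1..} \<and> integral {1..} F = mellin_unit (theta_excess a) s"
    using absolute_integral_change_of_variables_complex[of "{0<..1}" ?g "\<lambda>u. - 1 / u\<^sup>2" F "mellin_unit (theta_excess a) s"]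
    unfolding img by (auto simp: inj_on_def)
  have un: "{0<..} = {0<..1} \<union> {1::real..}" by auto
  show "F absolutely_integrable_on {0<..}"
    unfolding un using ab1 F2 by (intro set_integrable_Un) auto
  have "integral {0<..} F = integral {0<..1} F + integral {1..} F"
    unfolding un using ab1 F2
    by (intro integral_Un) (auto intro: set_lebesgue_integral_eq_integral(1) negligible_subset[of "{1}"])
  thus "integral {0<..} F = mellin_unit (theta_excess a) s
           + mellin_unit (theta_excess ?b) (of_real (real CARD('n) / 2) - s)
           + 1 / (s - of_real (real CARD('n) / 2)) - 1 / s"
    using I1 F2 by (simp add: r_def)
qed

text \<open>Integrate the series for \<open>E\<close> term by term. Absolute convergence of the
  Dirichlet series comes out of the integrability of the total, without any separate estimate of the
  \<open>lam k\<close>.\<close>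

lemma mellin_transform_has_sum:
  fixes s :: complex and E :: "real \<Rightarrow> real"
  assumes e: "bij_betw e (UNIV :: nat set) K" and s: "Re s > 0"
    and pos: "\<And>k. k \<in> K \<Longrightarrow> lam k > 0"
    and sum: "\<And>t. t > 0 \<Longrightarrow> ((\<lambda>k. exp (- (lam k * t))) has_sum E t) K"
    and int: "(\<lambda>t. of_real (E t) * of_real t powr (s - 1)) absolutely_integrable_on {0<..}"
  shows "((\<lambda>k. Gamma s * of_real (lam k) powr (- s)) has_sum
           integral {0<..} (\<lambda>t. of_real (E t) * of_real t powr (s - 1))) K"
proof -
  let ?p = "\<lambda>i t. of_real (exp (- (lam (e i) * t))) * of_real t powr (s - 1) :: complex"
  let ?G = "\<lambda>t. of_real (E t) * of_real t powr (s - 1) :: complex"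
  define f where "f = (\<lambda>i t. indicat_real {0<..} t *\<^sub>R ?p i t)"
  define G where "G = (\<lambda>t. indicat_real {0<..} t *\<^sub>R ?G t)"
  have lam: "lam (e i) > 0" for i using pos e by (auto simp: bij_betw_def)
  have sums: "(\<lambda>i. exp (- (lam (e i) * t))) sums E t" if "t > 0" for t
    using sum[OF that] has_sum_reindex_bij_betw[OF e, of "\<lambda>k. exp (- (lam k * t))"]
    by (intro has_sum_imp_sums) simp
  have f: "integrable lebesgue (f i)" for i
    using exp_mellin_transform(1)[OF s lam] by (simp add: f_def set_integrable_def)
  have f_val: "integral\<^sup>L lebesgue (f i) = Gamma s * of_real (lam (e i)) powr (- s)" for i
    using set_lebesgue_integral_eq_integral(2)[OF exp_mellin_transform(1)[OF s lam]]
      exp_mellin_transform(2)[OF s lam]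
    by (simp add: f_def set_lebesgue_integral_def)
  have G: "integrable lebesgue G" using int by (simp add: G_def set_integrable_def)
  have G_val: "integral\<^sup>L lebesgue G = integral {0<..} ?G"
    using set_lebesgue_integral_eq_integral(2)[OF int] by (simp add: G_def set_lebesgue_integral_def)
  have f_sums: "(\<lambda>i. f i t) sums G t" for t
  proof (cases "t > 0")
    case True
    hence "(\<lambda>i. ?p i t) sums ?G t" by (intro sums_mult2 sums_of_real sums)
    thus ?thesis using True by (simp add: f_def G_def)
  qed (simp add: f_def G_def)
  \<comment> \<open>At fixed \<open>t\<close> all terms are positive multiples of the same number
    \<open>t powr (s - 1)\<close>, so the norms add up without loss.\<close>
  have norm_sums: "(\<lambda>i. norm (f i t)) sums norm (G t)" for t
  proof (cases "t > 0")
    case True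
    have "E t \<ge> 0" by (rule sums_le[OF _ sums_zero sums[OF True]]) simp
    moreover have "(\<lambda>i. exp (- (lam (e i) * t)) * norm (of_real t powr (s - 1) :: complex))
        sums (E t * norm (of_real t powr (s - 1) :: complex))"
      by (intro sums_mult2 sums True)
    ultimately show ?thesis using True by (simp add: f_def G_def norm_mult)
  qed (simp add: f_def G_def)
  have "(\<Sum>i<n. integral\<^sup>L lebesgue (\<lambda>t. norm (f i t))) \<le> (integral\<^sup>L lebesgue (\<lambda>t. norm (G t)))" for n
  proof -
    have "(\<Sum>i<n. integral\<^sup>L lebesgue (\<lambda>t. norm (f i t))) = (integral\<^sup>L lebesgue (\<lambda>t. \<Sum>i<n. norm (f i t)))"
      by (rule Bochner_Integration.integral_sum[symmetric]) (intro integrable_norm f)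
    also have "\<dots> \<le> (integral\<^sup>L lebesgue (\<lambda>t. norm (G t)))"
    proof (rule integral_mono)
      fix t
      show "(\<Sum>i<n. norm (f i t)) \<le> norm (G t)"
        using sum_le_suminf[of "\<lambda>i. norm (f i t)" "{..<n}"] norm_sums[of t] by (simp add: sums_iff)
    qed (intro integrable_norm G f Bochner_Integration.integrable_sum)+
    finally show ?thesis .
  qed
  hence norm_summable: "summable (\<lambda>i. integral\<^sup>L lebesgue (\<lambda>t. norm (f i t)))"
    by (intro summableI_nonneg_bounded[where x="integral\<^sup>L lebesgue (\<lambda>t. norm (G t))"]) auto
  have "(\<lambda>i. integral\<^sup>L lebesgue (f i)) sums (integral\<^sup>L lebesgue (\<lambda>t. \<Sum>i. f i t))"
    by (rule sums_integral[OF f]) (use norm_sums norm_summable in \<open>auto simp: sums_iff\<close>)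
  also have "(\<lambda>t. \<Sum>i. f i t) = G" using f_sums by (auto simp: sums_iff)
  finally have "(\<lambda>i. integral\<^sup>L lebesgue (f i)) sums integral\<^sup>L lebesgue G" .
  moreover have "summable (\<lambda>i. norm (integral\<^sup>L lebesgue (f i)))"
    by (rule summable_comparison_test'[OF norm_summable]) simp
  ultimately have "((\<lambda>i. integral\<^sup>L lebesgue (f i)) has_sum integral\<^sup>L lebesgue G) UNIV"
    by (intro norm_summable_imp_has_sum)
  thus ?thesis
    using has_sum_reindex_bij_betw[OF e, of "\<lambda>k. Gamma s * of_real (lam k) powr (- s)"]
    by (simp add: f_val G_val)
qed

subsection \<open>The continued zeta function and the determinant\<close>

text \<open>A meromorphic difference either vanishes or is nonzero off a sparse set, and the
  half-plane of convergence excludes the second case.\<close>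

lemma zeta_continuation_deriv_unique:
  fixes D :: "real^'n^'n"
  assumes Z1: "zeta_continuation D Z1" and Z2: "zeta_continuation D Z2"
  shows "deriv Z1 0 = deriv Z2 0"
proof -
  define h where "h = (\<lambda>s. Z1 s - Z2 s)"
  have "h meromorphic_on UNIV"
    using Z1 Z2 unfolding h_def zeta_continuation_def by (intro meromorphic_on_diff) auto
  hence "eventually (\<lambda>s. h s = 0) (cosparse UNIV) \<or> eventually (\<lambda>s. h s \<noteq> 0) (cosparse UNIV)"
    by (intro meromorphic_imp_constant_or_avoid) auto
  moreover have "\<not> eventually (\<lambda>s. h s \<noteq> 0) (cosparse UNIV)"
  proof
    define c where "c = complex_of_real (real CARD('n) / 2 + 1)"
    assume "eventually (\<lambda>s. h s \<noteq> 0) (cosparse UNIV)"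
    hence "eventually (\<lambda>s. h s \<noteq> 0) (at c)" by (simp add: eventually_cosparse_open_eq)
    moreover have "eventually (\<lambda>s. s \<in> {s. Re s > real CARD('n) / 2}) (nhds c)"
      by (rule eventually_nhds_in_open[OF open_halfspace_Re_gt]) (simp add: c_def)
    hence "eventually (\<lambda>s. h s = 0) (at c)"
      using Z1 Z2 by (auto simp: h_def zeta_continuation_def eventually_at_filter elim!: eventually_mono)
    ultimately have "eventually (\<lambda>_. False) (at c)" by eventually_elim simp
    thus False by simp
  qed
  ultimately have ev: "eventually (\<lambda>s. h s = 0) (at 0)" by (simp add: eventually_cosparse_open_eq)
  \<comment> \<open>So far \<open>h\<close> vanishes only on a punctured neighbourhood; continuity
    adds the point 0, where the derivatives are taken.\<close>
  have "h analytic_on {0}"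
    using Z1 Z2 unfolding h_def zeta_continuation_def by (intro analytic_on_diff) auto
  hence "(h \<longlongrightarrow> h 0) (at 0)" by (simp add: analytic_at_imp_isCont isContD)
  moreover have "(h \<longlongrightarrow> 0) (at 0)" using ev by (rule tendsto_eventually)
  ultimately have "h 0 = 0" by (rule LIM_unique)
  with ev have "eventually (\<lambda>s. Z1 s = Z2 s) (nhds 0)"
    by (auto simp: eventually_at_filter h_def elim!: eventually_mono)
  thus ?thesis by (rule deriv_cong_ev) simp
qed

text \<open>The pole \<open>- 1 / s\<close> of the completed zeta function is absorbed by \<open>rGamma s / s = rGamma (s + 1)\<close>.\<close>
definition torus_zeta :: "('n::finite \<Rightarrow> real) \<Rightarrow> complex \<Rightarrow> complex" where
  "torus_zeta a s = of_real (4 * pi) powr (- s) *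
     (rGamma s * (mellin_unit (theta_excess a) s
        + mellin_unit (theta_excess (\<lambda>j. 1 / a j)) (of_real (real CARD('n) / 2) - s)
        + 1 / (s - of_real (real CARD('n) / 2))) - rGamma (s + 1))"

lemma spectral_zeta_eq_torus_zeta:
  fixes D :: "real^'n^'n" and s :: complex
  assumes D: "\<And>j. D $ j $ j \<noteq> 0" "(\<Prod>j\<in>UNIV. (D $ j $ j)\<^sup>2) = 1" and s: "Re s > real CARD('n) / 2"
  shows "spectral_zeta D s = torus_zeta (\<lambda>j. 1 / (D $ j $ j)\<^sup>2) s"
proof -
  define a where "a = (\<lambda>j. 1 / (D $ j $ j)\<^sup>2)"
  have a: "a j > 0" "prod a UNIV = 1" for j using D by (auto simp: a_def prod_dividef)
  \<comment> \<open>The eigenvalue divided by \<open>4 * pi\<close>, which is the scaling of the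
    theta series; the factor \<open>(4 * pi) powr (- s)\<close> in \<open>torus_zeta\<close> makes
    up for it.\<close>
  define lam where "lam = (\<lambda>k::int^'n. pi * (\<Sum>j\<in>UNIV. a j * (of_int (k $ j))\<^sup>2))"
  let ?K = "UNIV - {0 :: int^'n}"
  let ?F = "\<lambda>t. of_real (theta_prod a t - 1) * of_real t powr (s - 1) :: complex"
  have s0: "Re s > 0" using s by (rule le_less_trans[rotated]) simp
  have lam0: "lam k > 0" if "k \<in> ?K" for k
  proof -
    from that obtain j where "k $ j \<noteq> 0" by (auto simp: vec_eq_iff)
    hence "(\<Sum>j\<in>UNIV. a j * (real_of_int (k $ j))\<^sup>2) > 0"
      using a(1) by (intro sum_pos2[of _ j]) (auto intro: mult_nonneg_nonneg[OF less_imp_le])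
    thus ?thesis by (simp add: lam_def)
  qed
  have "infinite ?K" by (simp add: infinite_UNIV_vec)
  hence e: "bij_betw (from_nat_into ?K) UNIV ?K" by (intro bij_betw_from_nat_into) auto
  have "((\<lambda>k. Gamma s * of_real (lam k) powr (- s)) has_sum integral {0<..} ?F) ?K"
  proof (rule mellin_transform_has_sum[OF e s0 lam0])
    fix t :: real assume t: "t > 0"
    have "((\<lambda>k. exp (- (lam k * t))) has_sum theta_prod a t) UNIV"
      using theta_prod_has_sum[OF t a(1)] by (simp add: lam_def mult_ac)
    hence "((\<lambda>k. exp (- (lam k * t))) has_sum (theta_prod a t - exp (- (lam 0 * t)))) ?K"
      by (rule has_sum_Diff) (auto intro: has_sum_finiteI)
    thus "((\<lambda>k. exp (- (lam k * t))) has_sum (theta_prod a t - 1)) ?K" by (simp add: lam_def)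
  qed (use mellin_theta_prod(1)[OF a s] in auto)
  hence "((\<lambda>k. of_real (4 * pi) powr (- s) * rGamma s * (Gamma s * of_real (lam k) powr (- s)))
      has_sum (of_real (4 * pi) powr (- s) * rGamma s * integral {0<..} ?F)) ?K"
    by (rule has_sum_cmult_right)
  moreover have "of_real (4 * pi) powr (- s) * rGamma s * (Gamma s * of_real (lam k) powr (- s))
      = of_real (laplace_eigenvalue D k) powr (- s)" if "k \<in> ?K" for k
  proof -
    have "s \<notin> \<int>\<^sub>\<le>\<^sub>0" using s0 by (auto elim!: nonpos_Ints_cases)
    hence "rGamma s * Gamma s = 1" by (simp add: Gamma_def rGamma_eq_zero_iff)
    moreover have "laplace_eigenvalue D k = 4 * pi * lam k"
      by (simp add: laplace_eigenvalue_def lam_def a_def power2_eq_square)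
    moreover have "(of_real (4 * pi * lam k) powr (- s) :: complex)
        = of_real (4 * pi) powr (- s) * of_real (lam k) powr (- s)"
      using lam0[OF that] by (simp only: of_real_mult[of "4 * pi"]) (subst powr_times_real, auto)
    ultimately show ?thesis by (simp add: mult_ac)
  qed
  ultimately have "((\<lambda>k. of_real (laplace_eigenvalue D k) powr (- s)) has_sum
      (of_real (4 * pi) powr (- s) * rGamma s * integral {0<..} ?F)) ?K"
    by (subst (asm) has_sum_cong) auto
  hence "spectral_zeta D s = of_real (4 * pi) powr (- s) * rGamma s * integral {0<..} ?F"
    unfolding spectral_zeta_def by (rule infsumI)
  also have "\<dots> = torus_zeta a s"
  proof -
    have "s \<noteq> 0" using s0 by auto
    hence "rGamma (s + 1) = rGamma s / s" using rGamma_plus1[of s] by (simp add: field_simps)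
    thus ?thesis unfolding mellin_theta_prod(2)[OF a s] torus_zeta_def by (simp only:) (simp add: algebra_simps)
  qed
  finally show ?thesis by (simp add: a_def)
qed

definition mellin_real :: "(real \<Rightarrow> real) \<Rightarrow> real \<Rightarrow> real" where
  "mellin_real h r = integral {0..1} (\<lambda>u. h u * u powr (- r - 1))"

text \<open>The only part of the derivative of the zeta function at 0 that depends on
  \<open>a\<close>. The arguments are \<open>s\<close> and \<open>n / 2 - s\<close> at
  \<open>s = 0\<close>.\<close>

definition zeta_height :: "('n::finite \<Rightarrow> real) \<Rightarrow> real" where
  "zeta_height a = mellin_real (theta_excess a) 0
     + mellin_real (theta_excess (\<lambda>j. 1 / a j)) (real CARD('n) / 2)"

lemma torus_zeta_analytic:
  fixes a :: "'n::finite \<Rightarrow> real"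
  assumes a: "\<And>j. a j > 0"
  shows "torus_zeta a meromorphic_on UNIV" and "torus_zeta a analytic_on {0}"
    and "deriv (torus_zeta a) 0 =
      of_real (zeta_height a - 2 / real CARD('n) + ln (4 * pi) - euler_mascheroni)"
proof -
  let ?b = "\<lambda>j. 1 / a j" and ?r = "real CARD('n) / 2"
  have b: "?b j > 0" for j using a by simp
  have hol: "mellin_unit (theta_excess a) holomorphic_on UNIV" "mellin_unit (theta_excess ?b) holomorphic_on UNIV"
    using mellin_unit_holomorphic[OF theta_excess_regular[of a, OF a]]
      mellin_unit_holomorphic[OF theta_excess_regular[of ?b, OF b]] by auto
  define M where "M = (\<lambda>s. mellin_unit (theta_excess a) s + mellin_unit (theta_excess ?b) (of_real ?r - s))"
  have "(mellin_unit (theta_excess ?b) \<circ> (\<lambda>s. of_real ?r - s)) holomorphic_on UNIV"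
    by (rule holomorphic_on_compose_gen[OF _ hol(2)]) (auto intro!: holomorphic_intros)
  hence M: "M holomorphic_on UNIV"
    unfolding M_def o_def by (intro holomorphic_on_add hol(1))
  hence M': "M analytic_on A" for A by (meson analytic_on_holomorphic open_UNIV subset_UNIV)
  have tz: "torus_zeta a = (\<lambda>s. of_real (4 * pi) powr (- s) * (rGamma s * (M s + 1 / (s - of_real ?r)) - rGamma (s + 1)))"
    by (rule ext) (simp only: torus_zeta_def M_def)
  have r0: "?r \<noteq> 0" by simp
  have pw: "(\<lambda>s. of_real (4 * pi) powr (- s) :: complex) analytic_on A" for A
    unfolding powr_def by (auto intro!: analytic_intros)
  show "torus_zeta a meromorphic_on UNIV"
    unfolding tz
    by (intro meromorphic_intros analytic_on_imp_meromorphic_on[OF M'] analytic_on_imp_meromorphic_on[OF pw]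
        analytic_on_imp_meromorphic_on[OF analytic_on_rGamma]) (auto intro!: analytic_intros)
  show "torus_zeta a analytic_on {0}"
    unfolding tz by (intro analytic_intros pw M') auto
  define M0 where "M0 = deriv M 0"
  have dM: "(M has_field_derivative M0) (at 0)"
    unfolding M0_def by (rule holomorphic_derivI[OF M]) auto
  have dG: "(rGamma has_field_derivative (1 :: complex)) (at 0)"
    using has_field_derivative_rGamma_nonpos_int[of 0 UNIV] by simp
  have dG1: "((\<lambda>s. rGamma (s + 1)) has_field_derivative (euler_mascheroni :: complex)) (at 0)"
  proof -
    have "(rGamma has_field_derivative (euler_mascheroni :: complex)) (at (0 + 1))"
      using has_field_derivative_rGamma_no_nonpos_int[of "1 :: complex" UNIV] by simp
    from DERIV_shift[THEN iffD1, OF this] show ?thesis by simp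
  qed
  define c where "c = complex_of_real (4 * pi)"
  define r where "r = complex_of_real ?r"
  have cr: "c \<noteq> 0" "r \<noteq> 0" by (simp_all add: c_def r_def)
  have d1: "((\<lambda>s. c powr (- s)) has_field_derivative - Ln c) (at 0)"
    using cr(1) unfolding powr_def by (auto intro!: derivative_eq_intros)
  have d2: "((\<lambda>s. 1 / (s - r)) has_field_derivative - 1 / r\<^sup>2) (at 0)"
    using cr(2) by (auto intro!: derivative_eq_intros simp: power2_eq_square)
  \<comment> \<open>Since \<open>rGamma 0 = 0\<close>, the derivative \<open>M0\<close> drops out
    and the bracket at 0 is \<open>- rGamma 1 = - 1\<close>; hence \<open>Ln c\<close> appears with
    a plus sign.\<close>
  have "(torus_zeta a has_field_derivative
      - Ln c * (rGamma 0 * (M 0 + 1 / (0 - r)) - rGamma (0 + 1))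
      + (1 * (M 0 + 1 / (0 - r)) + (M0 + - 1 / r\<^sup>2) * rGamma 0 - euler_mascheroni) * c powr (- 0)) (at 0)"
    unfolding tz c_def[symmetric] r_def[symmetric]
    by (intro DERIV_mult DERIV_diff DERIV_add d1 d2 dM dG dG1)
  hence "(torus_zeta a has_field_derivative M 0 - 1 / r + Ln c - euler_mascheroni) (at 0)"
    using cr by (simp add: algebra_simps)
  moreover have "M 0 = of_real (zeta_height a)"
  proof -
    have "mellin_unit (theta_excess a) (of_real 0) = of_real (mellin_real (theta_excess a) 0)"
      unfolding mellin_real_def by (rule mellin_unit_of_real(2)[OF theta_excess_regular[of a, OF a]])
    moreover have "mellin_unit (theta_excess ?b) (of_real ?r) = of_real (mellin_real (theta_excess ?b) ?r)"
      unfolding mellin_real_def by (rule mellin_unit_of_real(2)[OF theta_excess_regular[of ?b, OF b]])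
    ultimately show ?thesis unfolding M_def zeta_height_def by simp
  qed
  moreover have "Ln c = of_real (ln (4 * pi))" unfolding c_def by (rule Ln_of_real) simp
  moreover have "1 / r = of_real (2 / real CARD('n))" by (simp add: r_def)
  ultimately show "deriv (torus_zeta a) 0 =
      of_real (zeta_height a - 2 / real CARD('n) + ln (4 * pi) - euler_mascheroni)"
    by (simp add: DERIV_imp_deriv)
qed

lemma zeta_det_eq:
  fixes D :: "real^'n^'n"
  assumes D: "\<And>j. D $ j $ j \<noteq> 0" "(\<Prod>j\<in>UNIV. (D $ j $ j)\<^sup>2) = 1"
  shows "zeta_det D = exp (- (zeta_height (\<lambda>j. 1 / (D $ j $ j)\<^sup>2)
           - 2 / real CARD('n) + ln (4 * pi) - euler_mascheroni))"
proof -
  let ?a = "\<lambda>j. 1 / (D $ j $ j)\<^sup>2"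
  have a: "?a j > 0" for j using D(1) by simp
  have cont: "zeta_continuation D (torus_zeta ?a)"
    unfolding zeta_continuation_def
    using torus_zeta_analytic(1,2)[of ?a, OF a] spectral_zeta_eq_torus_zeta[OF D] by simp
  let ?d = "exp (- (zeta_height ?a - 2 / real CARD('n) + ln (4 * pi) - euler_mascheroni))"
  have d: "complex_of_real ?d = exp (- deriv (torus_zeta ?a) 0)"
    unfolding torus_zeta_analytic(3)[of ?a, OF a] by (simp only: of_real_minus[symmetric] exp_of_real)
  show ?thesis
    unfolding zeta_det_def
  proof (rule the_equality)
    fix d' assume "\<exists>Z. zeta_continuation D Z \<and> complex_of_real d' = exp (- deriv Z 0)"
    then obtain Z where Z: "zeta_continuation D Z" "complex_of_real d' = exp (- deriv Z 0)" by blast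
    hence "complex_of_real d' = complex_of_real ?d"
      using zeta_continuation_deriv_unique[OF Z(1) cont] d by simp
    thus "d' = ?d" by (simp only: of_real_eq_iff)
  qed (use cont d in blast)
qed

section \<open>Comparison with the cubic torus\<close>

text \<open>The integrands compare pointwise by \<open>prod_theta_ge\<close> at
  \<open>t = 1 / u\<close>. For strictness, a continuous nonnegative difference that is positive at
  \<open>u = 1\<close> cannot have integral 0.\<close>

lemma mellin_real_theta_excess_le:
  fixes a :: "'n::finite \<Rightarrow> real"
  assumes a: "\<And>j. a j > 0" "prod a UNIV = 1"
  shows "mellin_real (theta_excess (\<lambda>_::'n. 1)) r \<le> mellin_real (theta_excess a) r"
    and "a i \<noteq> 1 \<Longrightarrow> mellin_real (theta_excess (\<lambda>_::'n. 1)) r < mellin_real (theta_excess a) r"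
proof -
  let ?one = "\<lambda>_::'n. 1 :: real"
  let ?f = "\<lambda>a u. theta_excess a u * u powr (- r - 1)"
  have c: "continuous_on {0..1} (?f a)" "continuous_on {0..1} (?f ?one)"
    using mellin_unit_of_real(1)[OF theta_excess_regular[of a, OF a(1)]]
      mellin_unit_of_real(1)[OF theta_excess_regular[of ?one]] by auto
  define d where "d = (\<lambda>u. ?f a u - ?f ?one u)"
  have dc: "continuous_on {0..1} d" unfolding d_def by (intro continuous_intros c)
  have int: "integral {0..1} d = mellin_real (theta_excess a) r - mellin_real (theta_excess ?one) r"
    unfolding d_def mellin_real_def by (intro integral_diff integrable_continuous_real c)
  have d0: "d u \<ge> 0" if "u \<in> {0..1}" for u
  proof (cases "u = 0")
    case False
    hence "theta_excess ?one u \<le> theta_excess a u"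
      using prod_theta_ge(1)[of "1 / u" a, OF _ a] that by (simp add: theta_excess_def theta_prod_def)
    thus ?thesis by (simp add: d_def mult_right_mono)
  qed (simp add: d_def)
  have "integral {0..1} d \<ge> 0"
    using d0 by (intro integral_nonneg integrable_continuous_real dc) auto
  thus le: "mellin_real (theta_excess ?one) r \<le> mellin_real (theta_excess a) r" using int by simp
  assume "a i \<noteq> 1"
  hence "d 1 > 0"
    using prod_theta_ge(2)[of 1 a i, OF _ a] by (simp add: d_def theta_excess_def theta_prod_def)
  hence "integral {0..1} d \<noteq> 0"
    using integral_eq_0_iff[OF dc zero_less_one d0] by force
  thus "mellin_real (theta_excess ?one) r < mellin_real (theta_excess a) r" using int le by simp
qed

lemma zeta_height_le:
  fixes a :: "'n::finite \<Rightarrow> real"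
  assumes a: "\<And>j. a j > 0" "prod a UNIV = 1"
  shows "zeta_height (\<lambda>_::'n. 1) \<le> zeta_height a"
    and "a i \<noteq> 1 \<Longrightarrow> zeta_height (\<lambda>_::'n. 1) < zeta_height a"
proof -
  let ?b = "\<lambda>j. 1 / a j"
  have b: "?b j > 0" "prod ?b UNIV = 1" for j using a by (auto simp: prod_dividef)
  show "zeta_height (\<lambda>_::'n. 1) \<le> zeta_height a"
    using mellin_real_theta_excess_le(1)[of a 0, OF a] mellin_real_theta_excess_le(1)[of ?b "real CARD('n) / 2", OF b]
    by (simp add: zeta_height_def)
  show "zeta_height (\<lambda>_::'n. 1) < zeta_height a" if "a i \<noteq> 1"
    using mellin_real_theta_excess_le(2)[of a i 0, OF a that] mellin_real_theta_excess_le(1)[of ?b "real CARD('n) / 2", OF b]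
    by (simp add: zeta_height_def)
qed

section \<open>Equality of orthogonal lattices\<close>

lemma mem_lattice_of_diagonal:
  fixes D :: "real^'n^'n"
  assumes "diagonal_matrix D"
  shows "x \<in> lattice_of D \<longleftrightarrow> (\<exists>k :: int^'n. \<forall>i. x $ i = D $ i $ i * of_int (k $ i))"
proof -
  have "(D *v v) $ i = D $ i $ i * v $ i" for v i
  proof -
    have "(D *v v) $ i = (\<Sum>j\<in>UNIV. if j = i then D $ i $ i * v $ i else 0)"
      unfolding matrix_vector_mult_def vec_lambda_beta
      by (rule sum.cong) (use assms in \<open>auto simp: diagonal_matrix_def\<close>)
    thus ?thesis by simp
  qed
  thus ?thesis unfolding lattice_of_def by (auto simp: vec_eq_iff)
qed

lemma diagonal_matrix_mat_1: "diagonal_matrix (mat 1)"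
  by (simp add: diagonal_matrix_def mat_def)

text \<open>If the lattices agree, the unit vector along axis \<open>i\<close> makes the entry the
  inverse of an integer, and its image under \<open>D\<close> makes it an integer. Conversely, signs
  are absorbed into the integer coordinates.\<close>

lemma lattice_of_diagonal_eq_iff:
  fixes D :: "real^'n^'n"
  assumes D: "diagonal_matrix D"
  shows "lattice_of D = lattice_of (mat 1) \<longleftrightarrow> (\<forall>i. \<bar>D $ i $ i\<bar> = 1)"
proof
  assume eq: "lattice_of D = lattice_of (mat 1)"
  show "\<forall>i. \<bar>D $ i $ i\<bar> = 1"
  proof
    fix i
    have "axis i 1 \<in> lattice_of (mat 1 :: real^'n^'n)"
      unfolding mem_lattice_of_diagonal[OF diagonal_matrix_mat_1]
      by (intro exI[of _ "axis i 1"]) (auto simp: mat_def axis_def)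
    hence "axis i 1 \<in> lattice_of D" using eq by simp
    then obtain k :: "int^'n" where "(axis i 1 :: real^'n) $ i = D $ i $ i * of_int (k $ i)"
      unfolding mem_lattice_of_diagonal[OF D] by blast
    hence k: "D $ i $ i * of_int (k $ i) = 1" by simp
    have "axis i (D $ i $ i) \<in> lattice_of D"
      unfolding mem_lattice_of_diagonal[OF D] by (intro exI[of _ "axis i 1"]) (auto simp: axis_def)
    hence "axis i (D $ i $ i) \<in> lattice_of (mat 1 :: real^'n^'n)" using eq by simp
    then obtain l :: "int^'n" where "(axis i (D $ i $ i) :: real^'n) $ i = (mat 1 :: real^'n^'n) $ i $ i * of_int (l $ i)"
      unfolding mem_lattice_of_diagonal[OF diagonal_matrix_mat_1] by blast
    hence l: "D $ i $ i = of_int (l $ i)" by (simp add: mat_def)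
    have "l $ i * k $ i = 1" using k unfolding l by (metis of_int_1 of_int_eq_iff of_int_mult)
    hence "\<bar>l $ i * k $ i\<bar> = 1" by simp
    hence "\<bar>l $ i\<bar> = 1" by (rule abs_zmult_eq_1)
    thus "\<bar>D $ i $ i\<bar> = 1" unfolding l by (metis of_int_1 of_int_abs)
  qed
next
  assume D1: "\<forall>i. \<bar>D $ i $ i\<bar> = 1"
  define \<sigma> where "\<sigma> = (\<lambda>i. if D $ i $ i = 1 then 1 else - 1 :: int)"
  have \<sigma>: "D $ i $ i = of_int (\<sigma> i)" "\<sigma> i * \<sigma> i = 1" for i
  proof -
    have "D $ i $ i = 1 \<or> D $ i $ i = - 1" using spec[OF D1, of i] by linarith
    thus "D $ i $ i = of_int (\<sigma> i)" "\<sigma> i * \<sigma> i = 1" by (auto simp: \<sigma>_def)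
  qed
  have flip: "(\<exists>k::int^'n. \<forall>i. x $ i = D $ i $ i * of_int (k $ i)) \<longleftrightarrow> (\<exists>k::int^'n. \<forall>i. x $ i = of_int (k $ i))"
    for x :: "real^'n"
  proof safe
    fix k :: "int^'n" assume "\<forall>i. x $ i = D $ i $ i * of_int (k $ i)"
    thus "\<exists>k::int^'n. \<forall>i. x $ i = of_int (k $ i)"
      by (intro exI[of _ "\<chi> i. \<sigma> i * k $ i"]) (simp add: \<sigma>(1))
  next
    fix k :: "int^'n" assume "\<forall>i. x $ i = of_int (k $ i)"
    thus "\<exists>k::int^'n. \<forall>i. x $ i = D $ i $ i * of_int (k $ i)"
      by (intro exI[of _ "\<chi> i. \<sigma> i * k $ i"])
         (simp add: \<sigma> mult.assoc[symmetric] flip: of_int_mult)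
  qed
  show "lattice_of D = lattice_of (mat 1)"
    unfolding set_eq_iff mem_lattice_of_diagonal[OF D] mem_lattice_of_diagonal[OF diagonal_matrix_mat_1] flip
    by (simp add: mat_def)
qed

theorem theorem1p3:
  fixes D :: "real^'n^'n"
  assumes "CARD('n) \<ge> 2"
    and "diagonal_matrix D"
    and "invertible D"
    and "\<bar>det D\<bar> = 1"
  shows "zeta_det D \<le> zeta_det (mat 1 :: real^'n^'n)
       \<and> (zeta_det D = zeta_det (mat 1 :: real^'n^'n)
            \<longleftrightarrow> lattice_of D = lattice_of (mat 1 :: real^'n^'n))"
proof -
  let ?a = "\<lambda>j. 1 / (D $ j $ j)\<^sup>2"
  have det: "det D = (\<Prod>j\<in>UNIV. D $ j $ j)"
    using assms(2) by (intro det_diagonal) (simp add: diagonal_matrix_def)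
  have D0: "D $ j $ j \<noteq> 0" for j
  proof
    assume "D $ j $ j = 0"
    hence "det D = 0" unfolding det by (intro prod_zero) auto
    thus False using assms(4) by simp
  qed
  have "(\<Prod>j\<in>UNIV. (D $ j $ j)\<^sup>2) = \<bar>det D\<bar>\<^sup>2" by (simp add: det prod_power_distrib)
  hence D1: "(\<Prod>j\<in>UNIV. (D $ j $ j)\<^sup>2) = 1" by (simp add: assms(4))
  have a: "?a j > 0" "prod ?a UNIV = 1" for j using D0 D1 by (auto simp: prod_dividef)
  \<comment> \<open>Everything in the exponent that depends on the dimension alone; the determinant
    decreases as the height grows.\<close>
  define c where "c = 2 / real CARD('n) - ln (4 * pi) + euler_mascheroni"
  have c: "- (h - 2 / real CARD('n) + ln (4 * pi) - euler_mascheroni) = c - h" for h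
    by (simp add: c_def)
  have zD: "zeta_det D = exp (c - zeta_height ?a)"
    unfolding zeta_det_eq[OF D0 D1] by (simp only: c)
  have mat1: "(mat 1 :: real^'n^'n) $ j $ j = 1" for j by (simp add: mat_def)
  have z1: "zeta_det (mat 1 :: real^'n^'n) = exp (c - zeta_height (\<lambda>_::'n. 1))"
    by (subst zeta_det_eq) (simp_all only: mat1 c, simp_all)
  \<comment> \<open>The zeta function sees only squares of the entries, which matches the sign
    ambiguity of the lattice.\<close>
  have one: "\<bar>D $ i $ i\<bar> = 1 \<longleftrightarrow> ?a i = 1" for i
    using D0[of i] abs_square_eq_1[of "D $ i $ i"] by (auto simp: divide_eq_eq)
  show ?thesis
  proof (cases "\<forall>i. ?a i = 1")
    case True
    hence "?a = (\<lambda>_. 1)" by (simp only:)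
    hence "zeta_det D = zeta_det (mat 1 :: real^'n^'n)" unfolding zD z1 by (simp only:)
    thus ?thesis using True lattice_of_diagonal_eq_iff[OF assms(2)] one by simp
  next
    case False
    then obtain i where "?a i \<noteq> 1" by blast
    hence "zeta_det D < zeta_det (mat 1 :: real^'n^'n)"
      unfolding zD z1 using zeta_height_le(2)[of ?a i, OF a] by simp
    thus ?thesis using False lattice_of_diagonal_eq_iff[OF assms(2)] one by auto
  qed
qed

end
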